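(* Let $s,n$ be positive integers with $n\ge 72s$, and let $G$ be an $n$-vertex $s$-connector. Then there exists $U\subseteq V(G)$ with $|U|>n-s$ such that the induced subgraph $G[U]$ is $\lfloor n/(72s)\rfloor$-rigid.
   Context: All graphs are finite and simple. For a positive integer $s$, a graph $G$ is an $s$-connector if every two disjoint $s$-element sets of vertices of $G$ are joined by an edge (i.e. there is an edge with one endpoint in each set). Rigidity: a $d$-dimensional framework is a pair $(G,\mathbf{p})$ where $G=(V,E)$ is a graph and $\mathbf{p}:V\to\mathbb{R}^d$. It is rigid if every continuous motion of the vertices starting at $\mathbf{p}$ that preserves the lengths of all edges preserves the distances between all pairs of vertices. The map $\mathbf{p}$ is generic if the $d|V|$ coordinates of the points $\mathbf{p}(v)$, $v\in V$, are algebraically independent over $\mathbb{Q}$. For $d\ge 1$, $G$ is $d$-rigid if $(G,\mathbf{p})$ is rigid for a generic $\mathbf{p}:V\to\mathbb{R}^d$ (this does not depend on the choice of generic $\mathbf{p}$). By convention every graph is $0$-rigid. *)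

theory Defs
  imports
    "Graph_Theory.Digraph_Component"
    "HOL-Library.Poly_Mapping"
    "HOL-Analysis.Analysis"
begin

(* Finite simple graphs are given by the locale predicate graph of Graph_Theory: finite,
   loop-free, symmetric digraphs without parallel arcs.  An undirected edge uv is represented by
   the two arcs u -> v and v -> u, so adjacency is dominates G u v, and the subgraph induced by U
   is induce_subgraph G U. *)

definition s_connector :: "nat \<Rightarrow> ('a, 'b) pre_digraph \<Rightarrow> bool" where
  "s_connector s G \<longleftrightarrow>
     (\<forall>A B. A \<subseteq> verts G \<and> B \<subseteq> verts G \<and> card A = s \<and> card B = s \<and> A \<inter> B = {} \<longrightarrow>
        (\<exists>a\<in>A. \<exists>b\<in>B. dominates G a b))"

(* Since the dimension d is a term depending on other variables, R^d is the space
   Euclidean_space d, whose points are the x :: nat => real vanishing at all i >= d. *)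

definition euclidean_dist :: "nat \<Rightarrow> (nat \<Rightarrow> real) \<Rightarrow> (nat \<Rightarrow> real) \<Rightarrow> real" where
  "euclidean_dist d x y = L2_set (\<lambda>i. x i - y i) {..<d}"

definition placement :: "nat \<Rightarrow> ('a, 'b) pre_digraph \<Rightarrow> ('a \<Rightarrow> nat \<Rightarrow> real) \<Rightarrow> bool" where
  "placement d G p \<longleftrightarrow> (\<forall>v\<in>verts G. p v \<in> topspace (Euclidean_space d))"

(* P t v is the position of the vertex v at time t in [0, 1]. *)
definition edge_preserving_motion ::
  "nat \<Rightarrow> ('a, 'b) pre_digraph \<Rightarrow> ('a \<Rightarrow> nat \<Rightarrow> real) \<Rightarrow> (real \<Rightarrow> 'a \<Rightarrow> nat \<Rightarrow> real) \<Rightarrow> bool" where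
  "edge_preserving_motion d G p P \<longleftrightarrow>
     (\<forall>v\<in>verts G. continuous_map (top_of_set {0..1}) (Euclidean_space d) (\<lambda>t. P t v)) \<and>
     (\<forall>v\<in>verts G. P 0 v = p v) \<and>
     (\<forall>t\<in>{0..1}. \<forall>u\<in>verts G. \<forall>v\<in>verts G. dominates G u v \<longrightarrow>
        euclidean_dist d (P t u) (P t v) = euclidean_dist d (p u) (p v))"

definition rigid_framework ::
  "nat \<Rightarrow> ('a, 'b) pre_digraph \<Rightarrow> ('a \<Rightarrow> nat \<Rightarrow> real) \<Rightarrow> bool" where
  "rigid_framework d G p \<longleftrightarrow> placement d G p \<and>
     (\<forall>P. edge_preserving_motion d G p P \<longrightarrow>
        (\<forall>t\<in>{0..1}. \<forall>u\<in>verts G. \<forall>v\<in>verts G.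
           euclidean_dist d (P t u) (P t v) = euclidean_dist d (p u) (p v)))"

(* Multivariate polynomials over the rationals in variables X_i, i :: 'i, are finitely supported
   maps from monomials (finitely supported exponent functions) to coefficients. *)

definition rat_mpoly_eval :: "('i \<Rightarrow> real) \<Rightarrow> (('i \<Rightarrow>\<^sub>0 nat) \<Rightarrow>\<^sub>0 rat) \<Rightarrow> real" where
  "rat_mpoly_eval x f =
     (\<Sum>m\<in>Poly_Mapping.keys f. of_rat (Poly_Mapping.lookup f m) *
        (\<Prod>i\<in>Poly_Mapping.keys m. x i ^ Poly_Mapping.lookup m i))"

(* Algebraic independence over the rationals of the family (x i), i in I; as a statement about a
   family, it forces the x i to be pairwise distinct. *)
definition algebraically_independent_over_rat :: "'i set \<Rightarrow> ('i \<Rightarrow> real) \<Rightarrow> bool" where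
  "algebraically_independent_over_rat I x \<longleftrightarrow>
     (\<forall>f. f \<noteq> 0 \<and> (\<forall>m\<in>Poly_Mapping.keys f. Poly_Mapping.keys m \<subseteq> I) \<longrightarrow>
        rat_mpoly_eval x f \<noteq> 0)"

definition generic_placement ::
  "nat \<Rightarrow> ('a, 'b) pre_digraph \<Rightarrow> ('a \<Rightarrow> nat \<Rightarrow> real) \<Rightarrow> bool" where
  "generic_placement d G p \<longleftrightarrow> placement d G p \<and>
     algebraically_independent_over_rat (verts G \<times> {..<d}) (\<lambda>(v, i). p v i)"

(* Whether (G, p) is rigid does not depend on the choice of the generic p.  The first disjunct is
   the convention that every graph is 0-rigid. *)
definition d_rigid :: "nat \<Rightarrow> ('a, 'b) pre_digraph \<Rightarrow> bool" where
  "d_rigid d G \<longleftrightarrow> d = 0 \<or> (\<exists>p. generic_placement d G p \<and> rigid_framework d G p)"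

end

theory Submission
  imports Defs
begin

text \<open>Let \<open>d = n div (72 * s)\<close>.  Take \<open>3 * d\<close> disjoint sets of \<open>6 * s\<close> vertices and place
  \<^emph>\<open>all\<close> vertices of the \<open>i\<close>-th set at one point \<open>L i\<close>, where \<open>L 0, L 1, \<dots>\<close> are in general
  position.  An infinitesimal flex \<open>q\<close> makes \<open>q v \<bullet> (L i - L j)\<close> constant along the edges between
  the sets \<open>i\<close> and \<open>j\<close>, and the connector property makes these edges connect all but fewer than
  \<open>s\<close> vertices of either set.  After deleting the vertices which are exceptional for at least
  \<open>d\<close> other sets, \<open>q\<close> is constant on each set, hence a flex of the complete framework on
  \<open>3 * d\<close> points, hence trivial.  A further vertex with neighbours at \<open>d\<close> distinct points can be
  given a new point of its own, and the connector property shows that this process only stops when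
  fewer than \<open>s\<close> vertices are left.  Infinitesimal rigidity is an open condition and generic
  placements are dense, so a nearby generic placement is infinitesimally rigid in a whole
  neighbourhood.  Rigidity follows because the difference of two placements with equal edge
  lengths is a flex of their midpoint.\<close>


section \<open>Finite linear systems\<close>

text \<open>Orthogonal projection onto the span of the rows \<open>g j\<close>, by one Gram-Schmidt
  step per row. The rows may be linearly dependent.\<close>

lemma ex_orthogonal_residual:
  fixes g :: "'j \<Rightarrow> 'i \<Rightarrow> real" and x :: "'i \<Rightarrow> real"
  assumes J: "finite J" and I: "finite I"
  obtains b where "\<forall>j\<in>J. (\<Sum>i\<in>I. (x i - (\<Sum>k\<in>J. b k * g k i)) * g j i) = 0"
proof -
  have "\<exists>b. \<forall>j\<in>J. (\<Sum>i\<in>I. (x i - (\<Sum>k\<in>J. b k * g k i)) * g j i) = 0" for x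
    using J
  proof (induction J arbitrary: x rule: finite_induct)
    case empty
    then show ?case by simp
  next
    case (insert m J)
    obtain b where b: "\<forall>j\<in>J. (\<Sum>i\<in>I. (x i - (\<Sum>k\<in>J. b k * g k i)) * g j i) = 0"
      using insert.IH by blast
    obtain c where c: "\<forall>j\<in>J. (\<Sum>i\<in>I. (g m i - (\<Sum>k\<in>J. c k * g k i)) * g j i) = 0"
      using insert.IH by blast
    define r where "r i = x i - (\<Sum>k\<in>J. b k * g k i)" for i
    define h where "h i = g m i - (\<Sum>k\<in>J. c k * g k i)" for i
    \<comment> \<open>The coefficient of the projection of \<open>r\<close> onto \<open>h\<close>.
      If \<open>h\<close> vanishes on \<open>I\<close>, division by zero gives 0, which is also
      right. The new residual is orthogonal to the old rows and to \<open>h\<close>, hence to the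
      row \<open>g m\<close>, which is \<open>h\<close> plus a combination of old rows.\<close>
    define l where "l = (\<Sum>i\<in>I. r i * h i) / (\<Sum>i\<in>I. h i * h i)"
    define b' where "b' k = (if k = m then l else b k - l * c k)" for k
    have gm: "g m i = h i + (\<Sum>k\<in>J. c k * g k i)" for i
      by (simp add: h_def)
    have orth: "(\<Sum>i\<in>I. f i * (\<Sum>k\<in>J. c k * g k i)) = 0"
      if "\<forall>j\<in>J. (\<Sum>i\<in>I. f i * g j i) = 0" for f
    proof -
      have "(\<Sum>i\<in>I. f i * (\<Sum>k\<in>J. c k * g k i)) = (\<Sum>i\<in>I. \<Sum>k\<in>J. c k * (f i * g k i))"
        by (simp add: sum_distrib_left mult_ac)
      also have "\<dots> = (\<Sum>k\<in>J. c k * (\<Sum>i\<in>I. f i * g k i))"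
        by (subst sum.swap) (simp add: sum_distrib_left)
      finally show ?thesis using that by simp
    qed
    have "(\<Sum>k\<in>J. b' k * g k i) = (\<Sum>k\<in>J. b k * g k i) - l * (\<Sum>k\<in>J. c k * g k i)" for i
    proof -
      have "(\<Sum>k\<in>J. b' k * g k i) = (\<Sum>k\<in>J. b k * g k i - l * (c k * g k i))"
        using insert.hyps by (intro sum.cong) (auto simp: b'_def algebra_simps)
      then show ?thesis by (simp add: sum_subtractf sum_distrib_left)
    qed
    then have res: "x i - (\<Sum>k\<in>insert m J. b' k * g k i) = r i - l * h i" for i
      using insert.hyps by (simp add: r_def h_def b'_def algebra_simps)
    have rl: "(\<Sum>i\<in>I. (r i - l * h i) * f i) = (\<Sum>i\<in>I. r i * f i) - l * (\<Sum>i\<in>I. h i * f i)" for f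
      by (simp add: algebra_simps sum_subtractf sum_distrib_left)
    have J0: "\<forall>j\<in>J. (\<Sum>i\<in>I. (r i - l * h i) * g j i) = 0"
      using b c by (simp add: rl r_def[symmetric] h_def[symmetric])
    have hh: "(\<Sum>i\<in>I. r i * h i) = l * (\<Sum>i\<in>I. h i * h i)"
    proof (cases "(\<Sum>i\<in>I. h i * h i) = 0")
      case True
      then have "\<forall>i\<in>I. h i = 0"
        using I by (subst (asm) sum_nonneg_eq_0_iff) auto
      then show ?thesis using True by simp
    qed (simp add: l_def)
    have "(\<Sum>i\<in>I. (r i - l * h i) * g m i) = 0"
      using orth[OF J0] hh by (simp add: gm distrib_left sum.distrib rl)
    with J0 show ?case unfolding res[symmetric] by (metis insertE)
  qed
  from this[of x] obtain b where "\<forall>j\<in>J. (\<Sum>i\<in>I. (x i - (\<Sum>k\<in>J. b k * g k i)) * g j i) = 0" ..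
  then show thesis by (rule that)
qed

text \<open>The residual of \<open>y\<close> after projection onto the span of the rows lies in the
  kernel, so it vanishes.\<close>

lemma trivial_kernel_imp_span:
  fixes g :: "'j \<Rightarrow> 'i \<Rightarrow> real" and y :: "'i \<Rightarrow> real"
  assumes J: "finite J" and I: "finite I"
    and ker: "\<forall>x. (\<forall>j\<in>J. (\<Sum>i\<in>I. x i * g j i) = 0) \<longrightarrow> (\<forall>i\<in>I. x i = 0)"
  shows "\<exists>b. \<forall>i\<in>I. y i = (\<Sum>j\<in>J. b j * g j i)"
proof -
  obtain b where "\<forall>j\<in>J. (\<Sum>i\<in>I. (y i - (\<Sum>k\<in>J. b k * g k i)) * g j i) = 0"
    by (rule ex_orthogonal_residual[OF J I])
  then have "\<forall>i\<in>I. y i - (\<Sum>k\<in>J. b k * g k i) = 0"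
    by (rule mp[OF ker[THEN spec, of "\<lambda>i. y i - (\<Sum>k\<in>J. b k * g k i)"]])
  then show ?thesis by (intro exI[of _ b]) simp
qed

text \<open>A left inverse of the system still inverts a nearby system up to a small error.\<close>

lemma trivial_kernel_open:
  fixes g :: "'j \<Rightarrow> 'i \<Rightarrow> real"
  assumes J: "finite J" and I: "finite I"
    and ker: "\<forall>x. (\<forall>j\<in>J. (\<Sum>i\<in>I. x i * g j i) = 0) \<longrightarrow> (\<forall>i\<in>I. x i = 0)"
  shows "\<exists>e>0. \<forall>g' x. (\<forall>j\<in>J. \<forall>i\<in>I. \<bar>g' j i - g j i\<bar> < e) \<longrightarrow>
    (\<forall>j\<in>J. (\<Sum>i\<in>I. x i * g' j i) = 0) \<longrightarrow> (\<forall>i\<in>I. x i = 0)"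
proof -
  \<comment> \<open>The coefficients \<open>b i'\<close> write the unit vector at \<open>i'\<close>
    as a combination of rows, so \<open>b\<close> is a left inverse of the system.\<close>
  from trivial_kernel_imp_span[OF J I ker, of "\<lambda>i. if i = i' then 1 else 0" for i']
  have "\<forall>i'. \<exists>b. \<forall>i\<in>I. (if i = i' then 1 else 0) = (\<Sum>j\<in>J. b j * g j i)"
    by (intro allI)
  from choice[OF this] obtain b where b': "\<And>i'. \<forall>i\<in>I. (if i = i' then 1 else 0) = (\<Sum>j\<in>J. b i' j * g j i)"
    by blast
  then have b: "\<And>i' i. i \<in> I \<Longrightarrow> (\<Sum>j\<in>J. b i' j * g j i) = (if i = i' then 1 else 0)"
    by simp
  define B where "B = (\<Sum>i'\<in>I. \<Sum>j\<in>J. \<bar>b i' j\<bar>)"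
  have B0: "B \<ge> 0" unfolding B_def by (intro sum_nonneg) auto
  \<comment> \<open>\<open>B\<close> is the total absolute value of the left inverse and
    \<open>e * B < 1\<close>. A solution \<open>x\<close> of the perturbed system with 1-norm
    \<open>N\<close> then satisfies \<open>N \<le> e * B * N\<close>, which forces
    \<open>N = 0\<close>.\<close>
  define e where "e = 1 / (B + 1)"
  have e0: "e > 0" using B0 by (simp add: e_def)
  have eB: "e * B < 1" using B0 by (simp add: e_def field_simps)
  show ?thesis
  proof (rule exI[of _ e], intro conjI e0, intro allI impI)
    fix g' x
    assume near: "\<forall>j\<in>J. \<forall>i\<in>I. \<bar>g' j i - g j i\<bar> < e" and 0: "\<forall>j\<in>J. (\<Sum>i\<in>I. x i * g' j i) = 0"
    define N where "N = (\<Sum>i\<in>I. \<bar>x i\<bar>)"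
    have N0: "N \<ge> 0" unfolding N_def by (intro sum_nonneg) auto
    have *: "\<bar>x i'\<bar> \<le> (\<Sum>j\<in>J. \<bar>b i' j\<bar>) * (e * N)" if "i' \<in> I" for i'
    proof -
      have "x i' = (\<Sum>i\<in>I. x i * (\<Sum>j\<in>J. b i' j * g j i))"
        using that I by (simp add: b if_distrib cong: if_cong)
      also have "\<dots> = (\<Sum>j\<in>J. b i' j * (\<Sum>i\<in>I. x i * g j i))"
        by (simp add: sum_distrib_left mult_ac) (rule sum.swap)
      also have "\<dots> = (\<Sum>j\<in>J. b i' j * (\<Sum>i\<in>I. x i * (g j i - g' j i)))"
        using 0 by (simp add: right_diff_distrib sum_subtractf)
      finally have "\<bar>x i'\<bar> \<le> (\<Sum>j\<in>J. \<bar>b i' j\<bar> * \<bar>\<Sum>i\<in>I. x i * (g j i - g' j i)\<bar>)"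
        unfolding abs_mult[symmetric] by (simp only: sum_abs)
      also have "\<dots> \<le> (\<Sum>j\<in>J. \<bar>b i' j\<bar> * (e * N))"
      proof (intro sum_mono mult_left_mono)
        fix j assume j: "j \<in> J"
        have "\<bar>\<Sum>i\<in>I. x i * (g j i - g' j i)\<bar> \<le> (\<Sum>i\<in>I. \<bar>x i\<bar> * \<bar>g j i - g' j i\<bar>)"
          unfolding abs_mult[symmetric] by (rule sum_abs)
        also have "\<dots> \<le> (\<Sum>i\<in>I. \<bar>x i\<bar> * e)"
          using near j by (intro sum_mono mult_left_mono) (auto simp: abs_minus_commute less_imp_le)
        finally show "\<bar>\<Sum>i\<in>I. x i * (g j i - g' j i)\<bar> \<le> e * N"
          by (simp add: N_def sum_distrib_left mult.commute)
      qed auto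
      finally show ?thesis by (simp add: sum_distrib_right)
    qed
    have "N \<le> (\<Sum>i'\<in>I. (\<Sum>j\<in>J. \<bar>b i' j\<bar>) * (e * N))"
      unfolding N_def using * by (intro sum_mono) (simp add: N_def)
    also have "\<dots> = (e * B) * N" by (simp add: B_def sum_distrib_right sum_distrib_left mult_ac)
    finally have "(1 - e * B) * N \<le> 0" by (simp add: algebra_simps)
    then have "N = 0" using eB N0 by (smt (verit) mult_pos_pos)
    then show "\<forall>i\<in>I. x i = 0" using I by (simp add: N_def sum_nonneg_eq_0_iff)
  qed
qed


section \<open>Vertex classes in a connector\<close>

lemma card_double_count_le:
  assumes A: "finite A" and J: "finite J"
    and lower: "\<And>a. a \<in> A \<Longrightarrow> m \<le> card {j \<in> J. R a j}"
    and upper: "\<And>j. j \<in> J \<Longrightarrow> card {a \<in> A. R a j} \<le> k"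
  shows "m * card A \<le> k * card J"
proof -
  have "m * card A \<le> (\<Sum>a\<in>A. card {j \<in> J. R a j})"
    using sum_mono[of A "\<lambda>_. m", OF lower] by (simp add: mult.commute)
  also have "\<dots> = (\<Sum>a\<in>A. \<Sum>j\<in>J. if R a j then 1 else 0)"
    using J by (simp add: sum.If_cases Int_def)
  also have "\<dots> = (\<Sum>j\<in>J. \<Sum>a\<in>A. if R a j then 1 else 0)"
    by (rule sum.swap)
  also have "\<dots> = (\<Sum>j\<in>J. card {a \<in> A. R a j})"
    using A by (simp add: sum.If_cases Int_def)
  also have "\<dots> \<le> k * card J"
    using sum_mono[of J _ "\<lambda>_. k", OF upper] by (simp add: mult.commute)
  finally show ?thesis .
qed

text \<open>\<open>X Z i j\<close> is the union of all small sets without edges to the rest of the classes \<open>i\<close>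
  and \<open>j\<close>, except possibly into the set \<open>Z\<close> of deleted vertices.  A maximal small post-fixed point
  \<open>Z\<close> of the monotone operator \<open>F\<close> is a fixed point, so no further vertex has to be deleted.\<close>

lemma connector_peeling:
  fixes E :: "'a \<Rightarrow> 'a \<Rightarrow> bool" and P :: "nat \<Rightarrow> 'a set" and s d :: nat
  assumes s: "s > 0" and d: "d > 0"
    and fin: "\<And>i. i < 3 * d \<Longrightarrow> finite (P i)"
    and size: "\<And>i. i < 3 * d \<Longrightarrow> card (P i) \<ge> 6 * s"
    and disj: "\<And>i j. \<lbrakk>i < 3 * d; j < 3 * d; i \<noteq> j\<rbrakk> \<Longrightarrow> P i \<inter> P j = {}"
    and sym: "\<And>u v. E u v \<Longrightarrow> E v u"
    and conn: "\<And>i j A B. \<lbrakk>i < 3 * d; j < 3 * d; i \<noteq> j; A \<subseteq> P i; B \<subseteq> P j; s \<le> card A; s \<le> card B\<rbrakk>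
      \<Longrightarrow> \<exists>a\<in>A. \<exists>b\<in>B. E a b"
  obtains U :: "nat \<Rightarrow> 'a set" and X :: "nat \<Rightarrow> nat \<Rightarrow> 'a set" where
    "\<And>i. i < 3 * d \<Longrightarrow> U i \<subseteq> P i"
    "\<And>i. i < 3 * d \<Longrightarrow> 3 * s \<le> card (U i)"
    "\<And>i j. X i j = X j i"
    "\<And>i j. \<lbrakk>i < 3 * d; j < 3 * d; i \<noteq> j\<rbrakk> \<Longrightarrow> card (U i \<inter> X i j) < s"
    "\<And>i v. \<lbrakk>i < 3 * d; v \<in> U i\<rbrakk> \<Longrightarrow> card {j. j < 3 * d \<and> j \<noteq> i \<and> v \<in> X i j} < d"
    "\<And>i j (f :: 'a \<Rightarrow> real). \<lbrakk>i < 3 * d; j < 3 * d; i \<noteq> j;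
        \<And>u w. \<lbrakk>u \<in> U i; w \<in> U j; E u w\<rbrakk> \<Longrightarrow> f u = f w\<rbrakk>
      \<Longrightarrow> \<exists>c. \<forall>v\<in>(U i \<union> U j) - X i j. f v = c"
proof -
  \<comment> \<open>Deleted vertices are exempt at the far end of an edge, so enlarging
    \<open>Z\<close> weakens the condition. This makes \<open>X\<close> and \<open>F\<close>
    monotone.\<close>
  define noedge where
    "noedge Z W i j \<longleftrightarrow> (\<forall>u\<in>W \<inter> P i. \<forall>w\<in>P j - (W \<union> Z). \<not> E u w)" for Z W i j
  define small where
    "small Z i j W \<longleftrightarrow> W \<subseteq> P i \<union> P j \<and> card (W \<inter> P i) < s \<and> card (W \<inter> P j) < s \<and>
       noedge Z W i j \<and> noedge Z W j i" for Z i j W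
  define X where "X Z i j = \<Union>{W. small Z i j W}" for Z i j
  define F where
    "F Z = {v. \<exists>i<3*d. v \<in> P i \<and> d \<le> card {j \<in> {..<3*d} - {i}. v \<in> X Z i j}}" for Z
  define ok where "ok Z \<longleftrightarrow> (\<forall>i<3*d. card (Z \<inter> P i) < 3 * s)" for Z
  have small_sym: "small Z i j W \<longleftrightarrow> small Z j i W" for Z i j W
    by (auto simp: small_def)
  then have X_sym: "X Z i j = X Z j i" for Z i j
    by (auto simp: X_def)
  have X_mono: "X Z i j \<subseteq> X Z' i j" if "Z \<subseteq> Z'" for Z Z' i j
  proof -
    have ne: "noedge Z' W i j" if "noedge Z W i j" for W i j
      using that \<open>Z \<subseteq> Z'\<close> unfolding noedge_def by blast
    have "small Z' i j W" if "small Z i j W" for W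
      using that ne unfolding small_def by metis
    then show ?thesis unfolding X_def by blast
  qed
  have F_mono: "F Z \<subseteq> F Z'" if "Z \<subseteq> Z'" for Z Z'
  proof
    fix v assume "v \<in> F Z"
    then obtain i where i: "i < 3*d" "v \<in> P i" "d \<le> card {j \<in> {..<3*d} - {i}. v \<in> X Z i j}"
      by (auto simp: F_def)
    have "card {j \<in> {..<3*d} - {i}. v \<in> X Z i j} \<le> card {j \<in> {..<3*d} - {i}. v \<in> X Z' i j}"
      using X_mono[OF that] by (intro card_mono) auto
    with i(3) have "d \<le> card {j \<in> {..<3*d} - {i}. v \<in> X Z' i j}" by (rule le_trans)
    with i show "v \<in> F Z'" unfolding F_def mem_Collect_eq by (intro exI[of _ i] conjI)
  qed
  \<comment> \<open>If the union had \<open>s\<close> vertices in class \<open>i\<close>, the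
    connector property would give an edge from it to the rest of class \<open>j\<close>. That rest
    has more than \<open>s\<close> vertices: from at least \<open>6 * s\<close> one removes fewer
    than \<open>s\<close>, \<open>s\<close> and \<open>3 * s\<close>.\<close>
  have un1: "card ((W \<union> W') \<inter> P i) < s"
    if Z: "ok Z" and ij: "i < 3*d" "j < 3*d" "i \<noteq> j" and W: "small Z i j W" "small Z i j W'"
    for Z i j W W'
  proof (rule ccontr)
    assume "\<not> card ((W \<union> W') \<inter> P i) < s"
    then have 1: "s \<le> card ((W \<union> W') \<inter> P i)" by simp
    let ?B = "P j - (W \<union> W' \<union> Z)"
    have "card (P j) = card (?B \<union> (W \<inter> P j) \<union> (W' \<inter> P j) \<union> (Z \<inter> P j))"
      by (rule arg_cong[where f = card]) auto
    then have "card (P j) \<le> card ?B + card (W \<inter> P j) + card (W' \<inter> P j) + card (Z \<inter> P j)"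
      using card_Un_le[of "?B \<union> (W \<inter> P j) \<union> (W' \<inter> P j)" "Z \<inter> P j"]
        card_Un_le[of "?B \<union> (W \<inter> P j)" "W' \<inter> P j"] card_Un_le[of ?B "W \<inter> P j"]
      by linarith
    moreover have "card (Z \<inter> P j) < 3 * s" using Z ij by (simp add: ok_def)
    moreover have "card (W \<inter> P j) < s" "card (W' \<inter> P j) < s" using W by (auto simp: small_def)
    ultimately have 2: "s \<le> card ?B" using size[OF ij(2)] by linarith
    obtain a b where "a \<in> (W \<union> W') \<inter> P i" "b \<in> ?B" "E a b"
      using conn[OF ij _ _ 1 2] by auto
    then show False using W by (auto simp: small_def noedge_def)
  qed
  have small_un: "small Z i j (W \<union> W')"
    if "ok Z" "i < 3*d" "j < 3*d" "i \<noteq> j" "small Z i j W" "small Z i j W'" for Z i j W W'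
    unfolding small_def
  proof (intro conjI)
    show "card ((W \<union> W') \<inter> P i) < s" "card ((W \<union> W') \<inter> P j) < s"
      using un1[of Z i j W W'] un1[of Z j i W W'] that small_sym by auto
  qed (use that in \<open>auto simp: small_def noedge_def\<close>)
  \<comment> \<open>There are only finitely many small sets and they are closed under union, so
    their union \<open>X Z i j\<close> is itself small.\<close>
  have X_small: "small Z i j (X Z i j)"
    if ij: "i < 3*d" "j < 3*d" "i \<noteq> j" and Z: "ok Z" for Z i j
  proof -
    have "finite {W. small Z i j W}"
      by (rule finite_subset[of _ "Pow (P i \<union> P j)"]) (use fin ij in \<open>auto simp: small_def\<close>)
    moreover have "small Z i j (\<Union>\<W>)" if "finite \<W>" "\<W> \<subseteq> {W. small Z i j W}" for \<W>
      using that
    proof (induction \<W> rule: finite_induct)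
      case empty
      then show ?case using s by (simp add: small_def noedge_def)
    next
      case (insert W \<W>)
      then show ?case using small_un[OF Z ij] by simp
    qed
    ultimately show ?thesis unfolding X_def by blast
  qed
  \<comment> \<open>Each vertex of \<open>F Z\<close> in class \<open>i\<close> lies in
    \<open>X Z i j\<close> for at least \<open>d\<close> of the \<open>3 * d - 1\<close> other
    indices \<open>j\<close>, and each \<open>X Z i j\<close> has at most \<open>s - 1\<close>
    vertices in class \<open>i\<close>. Double counting gives fewer than \<open>3 * s\<close> such
    vertices.\<close>
  have F_ok: "ok (F Z)" if Z: "ok Z" for Z
    unfolding ok_def
  proof (intro allI impI)
    fix i assume i: "i < 3*d"
    have Fi: "F Z \<inter> P i = {v \<in> P i. d \<le> card {j \<in> {..<3*d} - {i}. v \<in> X Z i j}}"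
      unfolding F_def using disj i by blast
    have "d * card (F Z \<inter> P i) \<le> (s - 1) * card ({..<3*d} - {i})"
    proof (rule card_double_count_le)
      show "finite (F Z \<inter> P i)" using fin i by auto
      show "d \<le> card {j \<in> {..<3*d} - {i}. a \<in> X Z i j}" if "a \<in> F Z \<inter> P i" for a
        using that unfolding Fi by simp
      show "card {a \<in> F Z \<inter> P i. a \<in> X Z i j} \<le> s - 1" if "j \<in> {..<3*d} - {i}" for j
      proof -
        have "card {a \<in> F Z \<inter> P i. a \<in> X Z i j} \<le> card (X Z i j \<inter> P i)"
          using fin i by (intro card_mono) auto
        also have "\<dots> < s" using X_small[of i j Z] Z that i by (auto simp: small_def)
        finally show ?thesis by simp
      qed
    qed simp
    also have "\<dots> < s * (3 * d)"
    proof (rule le_less_trans)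
      show "(s - 1) * card ({..<3*d} - {i}) \<le> (s - 1) * (3*d)"
        using i by (intro mult_le_mono2) auto
      show "(s - 1) * (3 * d) < s * (3 * d)"
        using s d by simp
    qed
    finally have "d * card (F Z \<inter> P i) < d * (3 * s)" by (simp add: mult_ac)
    then show "card (F Z \<inter> P i) < 3 * s" by simp
  qed
  let ?Fam = "{Z. Z \<subseteq> (\<Union>i<3*d. P i) \<and> ok Z \<and> Z \<subseteq> F Z}"
  have "finite ?Fam"
    by (rule finite_subset[of _ "Pow (\<Union>i<3*d. P i)"]) (use fin in auto)
  moreover have "{} \<in> ?Fam" using s by (simp add: ok_def)
  ultimately obtain Z where Z: "Z \<in> ?Fam" and max: "\<And>Z'. Z' \<in> ?Fam \<Longrightarrow> Z \<subseteq> Z' \<Longrightarrow> Z' = Z"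
    using finite_has_maximal[of ?Fam] by (metis (no_types, lifting) empty_iff)
  have okZ: "ok Z" and ZF: "Z \<subseteq> F Z" using Z by auto
  \<comment> \<open>Monotonicity turns \<open>Z \<subseteq> F Z\<close> into
    \<open>F Z \<subseteq> F (F Z)\<close>, so maximality of \<open>Z\<close> applies to
    \<open>F Z\<close>.\<close>
  have "F Z \<in> ?Fam"
    using F_ok[OF okZ] F_mono[OF ZF] by (auto simp: F_def)
  with max ZF have FZ: "F Z = Z" by blast
  define U where "U i = P i - Z" for i
  have cardU: "3 * s \<le> card (U i)" if i: "i < 3*d" for i
  proof -
    have "card (P i) = card (Z \<inter> P i) + card (U i)"
      unfolding U_def using card_Int_Diff[OF fin[OF i], of Z] by (simp add: Int_commute)
    moreover have "card (Z \<inter> P i) < 3 * s" using okZ i by (auto simp: ok_def)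
    ultimately show ?thesis using size[OF i] by linarith
  qed
  have cardX: "card (U i \<inter> X Z i j) < s" if ij: "i < 3*d" "j < 3*d" "i \<noteq> j" for i j
  proof -
    have "card (U i \<inter> X Z i j) \<le> card (X Z i j \<inter> P i)"
      using fin ij by (intro card_mono) (auto simp: U_def)
    also have "\<dots> < s" using X_small[OF ij okZ] by (auto simp: small_def)
    finally show ?thesis .
  qed
  show thesis
  proof (rule that)
    show "U i \<subseteq> P i" for i by (auto simp: U_def)
    show "3 * s \<le> card (U i)" if "i < 3*d" for i by (rule cardU[OF that])
    show "X Z i j = X Z j i" for i j by (rule X_sym)
    show "card (U i \<inter> X Z i j) < s" if "i < 3 * d" "j < 3 * d" "i \<noteq> j" for i j
      by (rule cardX[OF that])
    show "card {j. j < 3 * d \<and> j \<noteq> i \<and> v \<in> X Z i j} < d" if "i < 3 * d" "v \<in> U i" for i v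
    proof -
      have "v \<notin> F Z" "v \<in> P i" using that FZ by (auto simp: U_def)
      then have "card {j \<in> {..<3*d} - {i}. v \<in> X Z i j} < d"
        using that(1) by (auto simp: F_def not_le)
      also have "{j \<in> {..<3*d} - {i}. v \<in> X Z i j} = {j. j < 3 * d \<and> j \<noteq> i \<and> v \<in> X Z i j}" by auto
      finally show ?thesis .
    qed
    fix i j and f :: "'a \<Rightarrow> real"
    assume ij: "i < 3 * d" "j < 3 * d" "i \<noteq> j"
      and f: "\<And>u w. \<lbrakk>u \<in> U i; w \<in> U j; E u w\<rbrakk> \<Longrightarrow> f u = f w"
    define L where "L c = {v \<in> U i \<union> U j. f v = c}" for c
    have Pij: "P i \<inter> P j = {}" using disj ij by auto
    have finU: "finite (U i)" "finite (U j)" using fin ij by (auto simp: U_def)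
    have split: "card (U i - L c) + card (U i \<inter> L c) = card (U i)"
      "card (U j - L c) + card (U j \<inter> L c) = card (U j)" for c
      using card_Int_Diff[OF finU(1), of "L c"] card_Int_Diff[OF finU(2), of "L c"] by simp_all
    \<comment> \<open>An edge between the remaining vertices of the two classes never leaves a level
      set of \<open>f\<close>. This is applied to a single level set and to its complement.\<close>
    have ne: "noedge Z W i j" "noedge Z W j i"
      if W: "W \<inter> Z = {}" "\<And>u w. \<lbrakk>u \<in> U i; w \<in> U j; f u = f w\<rbrakk> \<Longrightarrow> u \<in> W \<longleftrightarrow> w \<in> W" for W
    proof -
      have *: "u \<in> W \<longleftrightarrow> w \<in> W" if "u \<in> P i" "u \<notin> Z" "w \<in> P j" "w \<notin> Z" "E u w" for u w
        using W(2)[of u w] f[of u w] that by (simp add: U_def)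
      show "noedge Z W i j" "noedge Z W j i"
        unfolding noedge_def using * sym W(1) by blast+
    qed
    have ne1: "noedge Z (L c) i j" "noedge Z (L c) j i"
      "noedge Z (U i \<union> U j - L c) i j" "noedge Z (U i \<union> U j - L c) j i" for c
      by (rule ne; auto simp: L_def U_def)+
    have big1: "card (U j - L c) < s" if c: "s \<le> card (U i \<inter> L c)" for c
    proof (rule ccontr)
      assume "\<not> card (U j - L c) < s"
      then have "s \<le> card (U j - L c)" by simp
      moreover have "U i \<inter> L c \<subseteq> P i" "U j - L c \<subseteq> P j" by (auto simp: U_def)
      ultimately obtain a b where "a \<in> U i \<inter> L c" "b \<in> U j - L c" "E a b"
        using conn[OF ij _ _ c] by blast
      then show False using f by (auto simp: L_def)
    qed
    have big2: "card (U i - L c) < s" if c: "s \<le> card (U j \<inter> L c)" for c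
    proof (rule ccontr)
      assume "\<not> card (U i - L c) < s"
      then have "s \<le> card (U i - L c)" by simp
      moreover have "U i - L c \<subseteq> P i" "U j \<inter> L c \<subseteq> P j" by (auto simp: U_def)
      ultimately obtain a b where "a \<in> U i - L c" "b \<in> U j \<inter> L c" "E a b"
        using conn[OF ij _ _ _ c] by blast
      then show False using f by (auto simp: L_def)
    qed
    \<comment> \<open>If every level set had fewer than \<open>s\<close> vertices in both classes,
      all of them would be small and \<open>X Z i j\<close> would cover \<open>U i\<close>, which
      has at least \<open>3 * s\<close> vertices.\<close>
    have "\<exists>c. s \<le> card (U i \<inter> L c) \<or> s \<le> card (U j \<inter> L c)"
    proof (rule ccontr)
      assume no: "\<not> ?thesis"
      have LP: "L c \<inter> P i = U i \<inter> L c" "L c \<inter> P j = U j \<inter> L c" for c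
        using Pij by (auto simp: L_def U_def)
      have "small Z i j (L c)" for c
        using no ne1[of c] unfolding small_def LP by (auto simp: not_le) (auto simp: L_def U_def)
      then have "L c \<subseteq> X Z i j" for c by (auto simp: X_def)
      then have "U i \<inter> X Z i j = U i" by (auto simp: L_def)
      then show False using cardX[OF ij] cardU[OF ij(1)] by simp
    qed
    then obtain c where c: "s \<le> card (U i \<inter> L c) \<or> s \<le> card (U j \<inter> L c)" ..
    \<comment> \<open>A level set with \<open>s\<close> vertices in one class misses fewer than
      \<open>s\<close> of the other, so it has at least \<open>s\<close> there too, and the argument
      can be repeated in the opposite direction. The complement of the level set is therefore small
      and contained in \<open>X Z i j\<close>.\<close>
    have lt: "card (U i - L c) < s" "card (U j - L c) < s"
      using c big1[of c] big2[of c] split[of c] cardU[OF ij(1)] cardU[OF ij(2)] by linarith+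
    have LP: "(U i \<union> U j - L c) \<inter> P i = U i - L c" "(U i \<union> U j - L c) \<inter> P j = U j - L c"
      using Pij by (auto simp: U_def)
    have "small Z i j (U i \<union> U j - L c)"
      using lt ne1[of c] unfolding small_def LP by (auto simp: U_def)
    then have "U i \<union> U j - L c \<subseteq> X Z i j" by (auto simp: X_def)
    then have "\<forall>v\<in>(U i \<union> U j) - X Z i j. f v = c"
      by (auto simp: L_def)
    then show "\<exists>c. \<forall>v\<in>(U i \<union> U j) - X Z i j. f v = c" ..
  qed
qed


section \<open>Points in general position\<close>

text \<open>The points are \<open>(L\<^sub>1(i), \<dots>, L\<^sub>d(i))\<close> for the Lagrange basis polynomials
  \<open>L\<^sub>k\<close> on the nodes \<open>0, \<dots>, d\<close>: a vector orthogonal to \<open>d\<close> differences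
  with the point \<open>i\<close> yields a polynomial of degree at most \<open>d\<close> with \<open>d + 1\<close> roots.\<close>

lemma ex_general_position_sequence:
  fixes d :: nat
  obtains L :: "nat \<Rightarrow> nat \<Rightarrow> real" where
    "\<forall>k<d. L 0 k = 0"
    "\<forall>i<d. \<forall>k<d. L (Suc i) k = (if i = k then 1 else 0)"
    "\<forall>i J y. finite J \<and> d \<le> card J \<and> i \<notin> J \<and> (\<forall>j\<in>J. (\<Sum>k<d. y k * (L i k - L j k)) = 0) \<longrightarrow>
       (\<forall>k<d. y k = 0)"
proof -
  define p :: "nat \<Rightarrow> real poly" where
    "p k = (\<Prod>m\<in>{..d} - {Suc k}. smult (1 / (real (Suc k) - real m)) [:- real m, 1:])" for k
  define L where "L i k = poly (p k) (real i)" for i k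
  have poly_p: "poly (p k) x = (\<Prod>m\<in>{..d} - {Suc k}. (x - real m) / (real (Suc k) - real m))" for k x
    by (simp add: p_def poly_prod diff_divide_distrib)
  have deg: "degree (p k) \<le> d" if "k < d" for k
  proof -
    have "degree (p k) \<le> (\<Sum>m\<in>{..d} - {Suc k}. degree (smult (1 / (real (Suc k) - real m)) [:- real m, 1:]))"
      unfolding p_def by (rule degree_prod_sum_le[THEN order_trans]) (simp_all add: o_def)
    also have "\<dots> \<le> (\<Sum>m\<in>{..d} - {Suc k}. 1)"
      by (intro sum_mono) (simp add: degree_smult_eq)
    also have "\<dots> = d" using that by simp
    finally show ?thesis .
  qed
  have L0: "L 0 k = 0" if "k < d" for k
    using that unfolding L_def poly_p by (intro prod_zero) auto
  have L1: "L (Suc i) k = (if i = k then 1 else 0)" if "i < d" "k < d" for i k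
  proof (cases "i = k")
    case True
    then show ?thesis unfolding L_def poly_p by (auto intro!: prod.neutral)
  next
    case False
    then have "L (Suc i) k = 0"
      using that unfolding L_def poly_p by (intro prod_zero bexI[of _ "Suc i"]) auto
    with False show ?thesis by simp
  qed
  have gp: "\<forall>k<d. y k = 0"
    if J: "finite J" "d \<le> card J" "i \<notin> J" and 0: "\<forall>j\<in>J. (\<Sum>k<d. y k * (L i k - L j k)) = 0"
    for i J and y :: "nat \<Rightarrow> real"
  proof -
    define c where "c = (\<Sum>k<d. y k * L i k)"
    define f where "f = (\<Sum>k<d. smult (y k) (p k)) - [:c:]"
    have f: "poly f (real j) = (\<Sum>k<d. y k * L j k) - c" for j
      by (simp add: f_def poly_sum L_def)
    have roots: "poly f (real j) = 0" if "j \<in> insert i J" for j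
      using that 0 by (auto simp: f c_def right_diff_distrib sum_subtractf)
    have "degree f \<le> d"
      unfolding f_def
      by (intro degree_diff_le degree_sum_le) (auto simp: deg)
    have "f = 0"
    proof (rule ccontr)
      assume "f \<noteq> 0"
      then have fin: "finite {x. poly f x = 0}" by (rule poly_roots_finite)
      have "Suc d \<le> card (insert i J)" using J by simp
      also have "\<dots> = card (real ` insert i J)" by (intro card_image[symmetric] inj_onI) simp
      also have "\<dots> \<le> card {x. poly f x = 0}"
        using roots by (intro card_mono fin) auto
      also have "\<dots> \<le> degree f" by (rule card_poly_roots_bound[OF \<open>f \<noteq> 0\<close>])
      finally show False using \<open>degree f \<le> d\<close> by simp
    qed
    \<comment> \<open>The zero polynomial may be evaluated at any node: node \<open>0\<close> gives
      \<open>c = 0\<close>, and node \<open>Suc k\<close> then reads off \<open>y k\<close>.\<close>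
    then have eq: "(\<Sum>k<d. y k * L j k) = c" for j using f[of j] by simp
    have "c = 0" using eq[of 0] L0 by simp
    show ?thesis
    proof (intro allI impI)
      fix k assume k: "k < d"
      have "(\<Sum>l<d. y l * L (Suc k) l) = (\<Sum>l<d. if k = l then y l else 0)"
        using k by (intro sum.cong) (auto simp: L1)
      then show "y k = 0" using k eq[of "Suc k"] \<open>c = 0\<close> by simp
    qed
  qed
  show thesis by (rule that[of L]) (use L0 L1 gp in blast)+
qed


section \<open>Infinitesimal rigidity\<close>

definition sq_dist :: "nat \<Rightarrow> (nat \<Rightarrow> real) \<Rightarrow> (nat \<Rightarrow> real) \<Rightarrow> real" where
  "sq_dist d x y = (\<Sum>k<d. (x k - y k)\<^sup>2)"

text \<open>The kernel of the rigidity matrix: velocities \<open>q\<close> for which all squared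
  edge lengths have derivative zero. An edge between coincident points imposes no condition, which
  matters for the blown-up frameworks.\<close>

definition edge_flex ::
  "nat \<Rightarrow> ('a \<Rightarrow> 'a \<Rightarrow> bool) \<Rightarrow> 'a set \<Rightarrow> ('a \<Rightarrow> nat \<Rightarrow> real) \<Rightarrow> ('a \<Rightarrow> nat \<Rightarrow> real) \<Rightarrow> bool" where
  "edge_flex d E X p q \<longleftrightarrow>
     (\<forall>u\<in>X. \<forall>v\<in>X. E u v \<longrightarrow> (\<Sum>k<d. (q u k - q v k) * (p u k - p v k)) = 0)"

text \<open>The velocity fields of rigid motions: a translation \<open>t\<close> plus an
  infinitesimal rotation, that is, a skew-symmetric matrix \<open>S\<close>.\<close>

definition trivial_flex ::
  "nat \<Rightarrow> 'a set \<Rightarrow> ('a \<Rightarrow> nat \<Rightarrow> real) \<Rightarrow> ('a \<Rightarrow> nat \<Rightarrow> real) \<Rightarrow> bool" where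
  "trivial_flex d X p q \<longleftrightarrow>
     (\<exists>S t. (\<forall>k<d. \<forall>l<d. S k l = - S l k) \<and>
        (\<forall>v\<in>X. \<forall>k<d. q v k = t k + (\<Sum>l<d. S k l * p v l)))"

definition inf_rigid ::
  "nat \<Rightarrow> ('a \<Rightarrow> 'a \<Rightarrow> bool) \<Rightarrow> 'a set \<Rightarrow> ('a \<Rightarrow> nat \<Rightarrow> real) \<Rightarrow> bool" where
  "inf_rigid d E X p \<longleftrightarrow> (\<forall>q. edge_flex d E X p q \<longrightarrow> trivial_flex d X p q)"

text \<open>Affine spanning in dual form, which is a trivial-kernel condition and so fits the
  results on linear systems.\<close>

definition spanning :: "nat \<Rightarrow> 'a set \<Rightarrow> ('a \<Rightarrow> nat \<Rightarrow> real) \<Rightarrow> bool" where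
  "spanning d X p \<longleftrightarrow>
     (\<forall>y. (\<forall>u\<in>X. \<forall>v\<in>X. (\<Sum>k<d. y k * (p u k - p v k)) = 0) \<longrightarrow> (\<forall>k<d. y k = 0))"

lemma skew_quadratic_form_eq_0:
  fixes S :: "nat \<Rightarrow> nat \<Rightarrow> real"
  assumes "\<forall>k<d. \<forall>l<d. S k l = - S l k"
  shows "(\<Sum>k<d. \<Sum>l<d. S k l * z l * z k) = 0"
proof -
  have "(\<Sum>k<d. \<Sum>l<d. S k l * z l * z k) = (\<Sum>k<d. \<Sum>l<d. S l k * z k * z l)"
    by (rule sum.swap)
  also have "\<dots> = (\<Sum>k<d. \<Sum>l<d. - (S k l * z l * z k))"
  proof (intro sum.cong refl)
    fix k l assume "k \<in> {..<d}" "l \<in> {..<d}"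
    then have "S l k = - S k l" using assms by blast
    then show "S l k * z k * z l = - (S k l * z l * z k)" by simp
  qed
  finally have "(\<Sum>k<d. \<Sum>l<d. S k l * z l * z k) = - (\<Sum>k<d. \<Sum>l<d. S k l * z l * z k)"
    by (simp only: sum_negf)
  then show ?thesis by linarith
qed

text \<open>On the difference \<open>z\<close> of two points the velocities differ by
  \<open>S z\<close>, which is orthogonal to \<open>z\<close> since \<open>S\<close> is skew. As
  \<open>E\<close> is arbitrary, this also covers the complete graph.\<close>

lemma trivial_flex_imp_edge_flex:
  assumes "trivial_flex d X p q"
  shows "edge_flex d E X p q"
  unfolding edge_flex_def
proof (intro ballI impI)
  fix u v assume uv: "u \<in> X" "v \<in> X"
  obtain S t where S: "\<forall>k<d. \<forall>l<d. S k l = - S l k"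
    and q: "\<And>v k. \<lbrakk>v \<in> X; k < d\<rbrakk> \<Longrightarrow> q v k = t k + (\<Sum>l<d. S k l * p v l)"
    using assms unfolding trivial_flex_def by blast
  have "(\<Sum>k<d. (q u k - q v k) * (p u k - p v k))
      = (\<Sum>k<d. \<Sum>l<d. S k l * (p u l - p v l) * (p u k - p v k))"
  proof (intro sum.cong refl)
    fix k assume "k \<in> {..<d}"
    then have "q u k - q v k = (\<Sum>l<d. S k l * (p u l - p v l))"
      using uv by (simp add: q right_diff_distrib sum_subtractf)
    then show "(q u k - q v k) * (p u k - p v k) = (\<Sum>l<d. S k l * (p u l - p v l) * (p u k - p v k))"
      by (simp add: sum_distrib_right)
  qed
  then show "(\<Sum>k<d. (q u k - q v k) * (p u k - p v k)) = 0"
    using skew_quadratic_form_eq_0[OF S] by simp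
qed

lemma edge_flex_diff:
  assumes "edge_flex d E X p q" "edge_flex d E X p r"
  shows "edge_flex d E X p (\<lambda>v k. q v k - r v k)"
proof -
  have "(\<Sum>k<d. ((q u k - r u k) - (q v k - r v k)) * (p u k - p v k))
      = (\<Sum>k<d. (q u k - q v k) * (p u k - p v k)) - (\<Sum>k<d. (r u k - r v k) * (p u k - p v k))" for u v
    unfolding sum_subtractf[symmetric] by (intro sum.cong refl) (simp add: algebra_simps)
  then show ?thesis using assms by (simp add: edge_flex_def)
qed

text \<open>Generators of the trivial flexes: \<open>Inl m\<close> is the translation along axis
  \<open>m\<close>, and \<open>Inr (a, b)\<close> is the rotation in the plane of the axes
  \<open>a\<close> and \<open>b\<close>. The family is redundant: \<open>Inr (a, a)\<close> gives
  zero, and exchanging \<open>a\<close> and \<open>b\<close> changes the sign.\<close>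

definition motion_gen :: "('a \<Rightarrow> nat \<Rightarrow> real) \<Rightarrow> nat + nat \<times> nat \<Rightarrow> 'a \<times> nat \<Rightarrow> real" where
  "motion_gen p j = (\<lambda>(v, k). case j of
       Inl m \<Rightarrow> if k = m then 1 else 0
     | Inr (a, b) \<Rightarrow> (if k = a then p v b else 0) - (if k = b then p v a else 0))"

lemma sum_mult_delta:
  fixes f :: "nat \<Rightarrow> real"
  assumes "a < d"
  shows "(\<Sum>k<d. f k * (if k = a then c else 0)) = f a * c"
proof -
  have "(\<Sum>k<d. f k * (if k = a then c else 0)) = (\<Sum>k<d. if k = a then f a * c else 0)"
    by (intro sum.cong) auto
  then show ?thesis using assms by simp
qed

lemma sum_mult_delta':
  fixes f :: "nat \<Rightarrow> real"
  assumes "a < d"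
  shows "(\<Sum>k<d. f k * (if a = k then c k else 0)) = f a * c a"
proof -
  have "(\<Sum>k<d. f k * (if a = k then c k else 0)) = (\<Sum>k<d. if a = k then f a * c a else 0)"
    by (intro sum.cong) auto
  then show ?thesis using assms by simp
qed

text \<open>The rotation coefficients become a skew matrix by antisymmetrisation; the translation
  coefficients form the vector \<open>t\<close>.\<close>

lemma motion_gen_comb_trivial:
  "trivial_flex d X p (\<lambda>v k. \<Sum>j\<in>{..<d} <+> {..<d} \<times> {..<d}. b j * motion_gen p j (v, k))"
proof -
  define S where "S k l = b (Inr (k, l)) - b (Inr (l, k))" for k l
  have main: "(\<Sum>j\<in>{..<d} <+> {..<d} \<times> {..<d}. b j * motion_gen p j (v, k))
      = b (Inl k) + (\<Sum>l<d. S k l * p v l)" if k: "k < d" for v k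
  proof -
    have "(\<Sum>j\<in>{..<d} \<times> {..<d}. b (Inr j) * motion_gen p (Inr j) (v, k))
      = (\<Sum>c<d. \<Sum>a<d. b (Inr (a, c)) * (if k = a then p v c else 0))
        - (\<Sum>a<d. \<Sum>c<d. b (Inr (a, c)) * (if k = c then p v a else 0))"
      unfolding sum.swap[of _ "{..<d}" "{..<d}" , where g = "\<lambda>c a. b (Inr (a, c)) * (if k = a then p v c else 0)"]
      by (simp add: sum.cartesian_product' motion_gen_def right_diff_distrib sum_subtractf)
    also have "\<dots> = (\<Sum>l<d. S k l * p v l)"
      using k by (simp add: sum_mult_delta' S_def left_diff_distrib sum_subtractf)
    finally show ?thesis
      using k by (simp add: sum.Plus motion_gen_def sum_mult_delta'[of k d "\<lambda>m. b (Inl m)" "\<lambda>_. 1"])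
  qed
  show ?thesis
    unfolding trivial_flex_def
  proof (rule exI[of _ S], rule exI[of _ "\<lambda>k. b (Inl k)"], intro conjI)
    show "\<forall>k<d. \<forall>l<d. S k l = - S l k" by (simp add: S_def)
  qed (simp add: main)
qed

lemma ball_Plus: "(\<forall>j\<in>A <+> B. P j) \<longleftrightarrow> (\<forall>a\<in>A. P (Inl a)) \<and> (\<forall>b\<in>B. P (Inr b))"
  by (auto simp: Plus_def)

text \<open>Translations test the coordinate sums of \<open>q\<close>, and rotations test the
  symmetry of the matrix of moments of \<open>q\<close> against \<open>p\<close>.\<close>

lemma motion_gen_orthogonal_iff:
  assumes "finite X"
  shows "(\<forall>j\<in>{..<d} <+> {..<d} \<times> {..<d}. (\<Sum>i\<in>X \<times> {..<d}. case_prod q i * motion_gen p j i) = 0) \<longleftrightarrow>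
    (\<forall>k<d. (\<Sum>v\<in>X. q v k) = 0) \<and>
    (\<forall>k<d. \<forall>l<d. (\<Sum>v\<in>X. q v k * p v l) = (\<Sum>v\<in>X. q v l * p v k))"
proof -
  have 1: "(\<Sum>i\<in>X \<times> {..<d}. case_prod q i * motion_gen p (Inl m) i) = (\<Sum>v\<in>X. q v m)" if "m < d" for m
    using that sum_mult_delta[of m d _ 1] by (simp add: sum.cartesian_product' motion_gen_def)
  have 2: "(\<Sum>i\<in>X \<times> {..<d}. case_prod q i * motion_gen p (Inr (a, b)) i)
      = (\<Sum>v\<in>X. q v a * p v b) - (\<Sum>v\<in>X. q v b * p v a)" if "a < d" "b < d" for a b
    using that by (simp add: sum.cartesian_product' motion_gen_def right_diff_distrib sum_subtractf sum_mult_delta)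
  have "(\<forall>j\<in>{..<d} \<times> {..<d}. (\<Sum>i\<in>X \<times> {..<d}. case_prod q i * motion_gen p (Inr j) i) = 0) \<longleftrightarrow>
      (\<forall>k<d. \<forall>l<d. (\<Sum>v\<in>X. q v k * p v l) = (\<Sum>v\<in>X. q v l * p v k))"
    unfolding Ball_def split_paired_All mem_Times_iff fst_conv snd_conv lessThan_iff
    using 2 by (metis (no_types, lifting) eq_iff_diff_eq_0)
  moreover have "(\<forall>m\<in>{..<d}. (\<Sum>i\<in>X \<times> {..<d}. case_prod q i * motion_gen p (Inl m) i) = 0) \<longleftrightarrow>
      (\<forall>k<d. (\<Sum>v\<in>X. q v k) = 0)"
    unfolding Ball_def lessThan_iff using 1 by metis
  ultimately show ?thesis
    unfolding ball_Plus by blast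
qed

section \<open>Openness of infinitesimal rigidity and of spanning\<close>

text \<open>Adding the rows of the trivial motions to the rigidity matrix makes its kernel trivial
  exactly when the framework is infinitesimally rigid, which is then an open condition.\<close>

lemma inf_rigid_open:
  assumes X: "finite X" and p0: "inf_rigid d E X p0"
  shows "\<exists>e>0. \<forall>p. (\<forall>v\<in>X. \<forall>k<d. \<bar>p v k - p0 v k\<bar> < e) \<longrightarrow> inf_rigid d E X p"
proof -
  let ?T = "{..<d} <+> {..<d} \<times> {..<d}"
  define J where "J = {(u, w) \<in> X \<times> X. E u w} <+> ?T"
  define g where "g p j = (case j of
      Inl (u, w) \<Rightarrow> (\<lambda>(v, k). ((if v = u then 1 else 0) - (if v = w then 1 else 0)) * (p u k - p w k))
    | Inr m \<Rightarrow> motion_gen p m)" for p :: "'a \<Rightarrow> nat \<Rightarrow> real" and j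
  have "finite {(u, w) \<in> X \<times> X. E u w}"
    by (rule finite_subset[of _ "X \<times> X"]) (use X in auto)
  then have finJ: "finite J" unfolding J_def by simp
  have finI: "finite (X \<times> {..<d})" using X by simp
  have edge: "(\<Sum>i\<in>X \<times> {..<d}. x i * g p (Inl (u, w)) i) = (\<Sum>k<d. (x (u, k) - x (w, k)) * (p u k - p w k))"
    if "u \<in> X" "w \<in> X" for x p u w
  proof -
    have "(\<Sum>i\<in>X \<times> {..<d}. x i * g p (Inl (u, w)) i)
        = (\<Sum>k<d. \<Sum>v\<in>X. x (v, k) * (((if v = u then 1 else 0) - (if v = w then 1 else 0)) * (p u k - p w k)))"
      by (subst sum.swap) (simp add: sum.cartesian_product' g_def)
    also have "\<dots> = (\<Sum>k<d. (x (u, k) - x (w, k)) * (p u k - p w k))"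
    proof (intro sum.cong refl)
      fix k
      have "(\<Sum>v\<in>X. x (v, k) * (((if v = u then 1 else 0) - (if v = w then 1 else 0)) * (p u k - p w k)))
          = (\<Sum>v\<in>X. (if v = u then x (v, k) else 0) - (if v = w then x (v, k) else 0)) * (p u k - p w k)"
        unfolding sum_distrib_right by (intro sum.cong) auto
      also have "\<dots> = (x (u, k) - x (w, k)) * (p u k - p w k)"
        using that X by (simp add: sum_subtractf)
      finally show "(\<Sum>v\<in>X. x (v, k) * (((if v = u then 1 else 0) - (if v = w then 1 else 0)) * (p u k - p w k)))
          = (x (u, k) - x (w, k)) * (p u k - p w k)" .
    qed
    finally show ?thesis .
  qed
  have kernel_iff: "(\<forall>j\<in>J. (\<Sum>i\<in>X \<times> {..<d}. case_prod q i * g p j i) = 0) \<longleftrightarrow>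
      edge_flex d E X p q \<and> (\<forall>j\<in>?T. (\<Sum>i\<in>X \<times> {..<d}. case_prod q i * motion_gen p j i) = 0)" for p q
  proof -
    have "(\<forall>j\<in>J. (\<Sum>i\<in>X \<times> {..<d}. case_prod q i * g p j i) = 0) \<longleftrightarrow>
      (\<forall>u\<in>X. \<forall>w\<in>X. E u w \<longrightarrow> (\<Sum>i\<in>X \<times> {..<d}. case_prod q i * g p (Inl (u, w)) i) = 0) \<and>
      (\<forall>j\<in>?T. (\<Sum>i\<in>X \<times> {..<d}. case_prod q i * g p (Inr j) i) = 0)"
      unfolding J_def by (auto simp: Plus_def)
    also have "\<dots> \<longleftrightarrow> edge_flex d E X p q \<and> (\<forall>j\<in>?T. (\<Sum>i\<in>X \<times> {..<d}. case_prod q i * motion_gen p j i) = 0)"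
      by (simp add: edge edge_flex_def g_def[of _ "Inr _"])
    finally show ?thesis .
  qed
  have ker: "\<forall>x. (\<forall>j\<in>J. (\<Sum>i\<in>X \<times> {..<d}. x i * g p0 j i) = 0) \<longrightarrow> (\<forall>i\<in>X \<times> {..<d}. x i = 0)"
  proof (intro allI impI)
    fix x assume x0: "\<forall>j\<in>J. (\<Sum>i\<in>X \<times> {..<d}. x i * g p0 j i) = 0"
    define q where "q v k = x (v, k)" for v k
    have x: "x = case_prod q" by (auto simp: q_def)
    have flex: "edge_flex d E X p0 q"
      and orth0: "\<And>k. k < d \<Longrightarrow> (\<Sum>v\<in>X. q v k) = 0"
      and orth: "\<And>k l. \<lbrakk>k < d; l < d\<rbrakk> \<Longrightarrow> (\<Sum>v\<in>X. q v k * p0 v l) = (\<Sum>v\<in>X. q v l * p0 v k)"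
      using x0[unfolded x kernel_iff motion_gen_orthogonal_iff[OF X]] by blast+
    have "trivial_flex d X p0 q" using p0 flex by (simp add: inf_rigid_def)
    then obtain S t where S: "\<forall>k<d. \<forall>l<d. S k l = - S l k"
      and q: "\<And>v k. \<lbrakk>v \<in> X; k < d\<rbrakk> \<Longrightarrow> q v k = t k + (\<Sum>l<d. S k l * p0 v l)"
      unfolding trivial_flex_def by blast
    \<comment> \<open>Since \<open>q\<close> is trivial, its squared norm is a translation term,
      which vanishes because the coordinate sums of \<open>q\<close> are zero, plus the pairing of
      the skew \<open>S\<close> with \<open>A\<close>. Orthogonality to rotations makes
      \<open>A\<close> symmetric, so the pairing is zero as well.\<close>
    define A where "A k l = (\<Sum>v\<in>X. q v k * p0 v l)" for k l
    have "(\<Sum>v\<in>X. \<Sum>k<d. q v k * q v k) = (\<Sum>v\<in>X. \<Sum>k<d. q v k * t k + (\<Sum>l<d. S k l * (q v k * p0 v l)))"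
    proof (intro sum.cong refl)
      fix v k assume "v \<in> X" "k \<in> {..<d}"
      then have "q v k * q v k = q v k * (t k + (\<Sum>l<d. S k l * p0 v l))"
        using q[of v k] by simp
      then show "q v k * q v k = q v k * t k + (\<Sum>l<d. S k l * (q v k * p0 v l))"
        by (simp add: distrib_left sum_distrib_left mult_ac)
    qed
    also have "\<dots> = (\<Sum>k<d. \<Sum>v\<in>X. q v k * t k + (\<Sum>l<d. S k l * (q v k * p0 v l)))"
      by (rule sum.swap)
    also have "\<dots> = (\<Sum>k<d. (\<Sum>v\<in>X. q v k) * t k + (\<Sum>v\<in>X. \<Sum>l<d. S k l * (q v k * p0 v l)))"
      by (simp add: sum.distrib sum_distrib_right)
    also have "\<dots> = (\<Sum>k<d. \<Sum>l<d. S k l * A k l)"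
      unfolding A_def
      by (intro sum.cong refl) (subst sum.swap, simp add: orth0 sum_distrib_left)
    also have "\<dots> = 0"
    proof -
      have "(\<Sum>k<d. \<Sum>l<d. S k l * A k l) = (\<Sum>k<d. \<Sum>l<d. S l k * A l k)"
        by (rule sum.swap)
      also have "\<dots> = (\<Sum>k<d. \<Sum>l<d. - (S k l * A k l))"
      proof (intro sum.cong refl)
        fix k l assume kl: "k \<in> {..<d}" "l \<in> {..<d}"
        then have "S l k = - S k l" using S by blast
        moreover have "A l k = A k l" unfolding A_def using kl by (intro orth) auto
        ultimately show "S l k * A l k = - (S k l * A k l)" by simp
      qed
      finally have "(\<Sum>k<d. \<Sum>l<d. S k l * A k l) = - (\<Sum>k<d. \<Sum>l<d. S k l * A k l)"
        by (simp only: sum_negf)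
      then show ?thesis by linarith
    qed
    finally have "(\<Sum>v\<in>X. \<Sum>k<d. q v k * q v k) = 0" .
    then have "\<forall>v\<in>X. (\<Sum>k<d. q v k * q v k) = 0"
      using X by (subst (asm) sum_nonneg_eq_0_iff) (auto intro: sum_nonneg)
    then have "\<forall>v\<in>X. \<forall>k<d. q v k = 0"
      by (auto simp: sum_nonneg_eq_0_iff)
    then show "\<forall>i\<in>X \<times> {..<d}. x i = 0" by (auto simp: q_def)
  qed
  obtain e where e: "e > 0"
    and near: "\<forall>g' x. (\<forall>j\<in>J. \<forall>i\<in>X \<times> {..<d}. \<bar>g' j i - g p0 j i\<bar> < e) \<longrightarrow>
        (\<forall>j\<in>J. (\<Sum>i\<in>X \<times> {..<d}. x i * g' j i) = 0) \<longrightarrow> (\<forall>i\<in>X \<times> {..<d}. x i = 0)"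
    using trivial_kernel_open[OF finJ finI ker] by (elim exE conjE) (rule that)
  show ?thesis
  \<comment> \<open>Half of \<open>e\<close>, because an entry of an edge row is a difference of two
    coordinates of \<open>p\<close>.\<close>
  proof (rule exI[of _ "e / 2"], intro conjI allI impI)
    show "e / 2 > 0" using e by simp
    fix p assume "\<forall>v\<in>X. \<forall>k<d. \<bar>p v k - p0 v k\<bar> < e / 2"
    then have p: "\<And>v k. \<lbrakk>v \<in> X; k < d\<rbrakk> \<Longrightarrow> \<bar>p v k - p0 v k\<bar> < e / 2" by blast
    have close: "\<forall>j\<in>J. \<forall>i\<in>X \<times> {..<d}. \<bar>g p j i - g p0 j i\<bar> < e"
    proof (intro ballI)
      fix j i assume "j \<in> J" and i: "i \<in> X \<times> {..<d}"
      obtain v k where vk: "i = (v, k)" "v \<in> X" "k < d" using i by auto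
      consider u w where "j = Inl (u, w)" "u \<in> X" "w \<in> X" | m where "j = Inr (Inl m)" "m < d"
        | a b where "j = Inr (Inr (a, b))" "a < d" "b < d"
        using \<open>j \<in> J\<close> by (auto simp: J_def Plus_def)
      then show "\<bar>g p j i - g p0 j i\<bar> < e"
      proof cases
        case 1
        then show ?thesis
          using p[of u k] p[of w k] vk e by (auto simp: g_def abs_if split: if_splits)
      next
        case 2
        then show ?thesis using vk e by (auto simp: g_def motion_gen_def)
      next
        case 3
        then show ?thesis
          using p[of v a] p[of v b] vk e by (auto simp: g_def motion_gen_def abs_if split: if_splits)
      qed
    qed
    show "inf_rigid d E X p"
      unfolding inf_rigid_def
    proof (intro allI impI)
      fix q assume q: "edge_flex d E X p q"
      \<comment> \<open>Removing from \<open>q\<close> its projection onto the trivial flexes of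
        \<open>p\<close> leaves a flex in the kernel of the extended system. It vanishes on
        \<open>X\<close>, so \<open>q\<close> equals its trivial part there.\<close>
      obtain b where b: "\<forall>j\<in>?T. (\<Sum>i\<in>X \<times> {..<d}.
          (case_prod q i - (\<Sum>m\<in>?T. b m * motion_gen p m i)) * motion_gen p j i) = 0"
        by (rule ex_orthogonal_residual[OF _ finI, of ?T "case_prod q" "motion_gen p"]) auto
      define r where "r v k = (\<Sum>m\<in>?T. b m * motion_gen p m (v, k))" for v k
      have r: "trivial_flex d X p r"
        unfolding r_def by (rule motion_gen_comb_trivial)
      define q' where "q' v k = q v k - r v k" for v k
      have "edge_flex d E X p q'"
        unfolding q'_def by (intro edge_flex_diff q trivial_flex_imp_edge_flex r)
      moreover have eq: "case_prod q' = (\<lambda>i. case_prod q i - (\<Sum>m\<in>?T. b m * motion_gen p m i))"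
        by (auto simp: q'_def r_def)
      have "\<forall>j\<in>?T. (\<Sum>i\<in>X \<times> {..<d}. case_prod q' i * motion_gen p j i) = 0"
        using b by (simp only: eq)
      ultimately have "\<forall>j\<in>J. (\<Sum>i\<in>X \<times> {..<d}. case_prod q' i * g p j i) = 0"
        using kernel_iff by blast
      then have "\<forall>i\<in>X \<times> {..<d}. case_prod q' i = 0"
        by (rule near[THEN spec, THEN spec, THEN mp, OF close, THEN mp])
      then have "q v k = r v k" if "v \<in> X" "k < d" for v k
        using that by (auto simp: q'_def)
      with r show "trivial_flex d X p q"
        by (simp add: trivial_flex_def)
    qed
  qed
qed

text \<open>Openness of trivial kernels again, now with one row for each difference of two
  points.\<close>

lemma spanning_open:
  assumes X: "finite X" and p0: "spanning d X p0"
  shows "\<exists>e>0. \<forall>p. (\<forall>v\<in>X. \<forall>k<d. \<bar>p v k - p0 v k\<bar> < e) \<longrightarrow> spanning d X p"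
proof -
  define g where "g p j k = p (fst j) k - p (snd j) k" for p :: "'a \<Rightarrow> nat \<Rightarrow> real" and j k
  have spanning_iff: "spanning d X p \<longleftrightarrow>
      (\<forall>y. (\<forall>j\<in>X \<times> X. (\<Sum>k\<in>{..<d}. y k * g p j k) = 0) \<longrightarrow> (\<forall>k\<in>{..<d}. y k = 0))" for p
    unfolding spanning_def g_def split_paired_Ball_Sigma fst_conv snd_conv
      Ball_def[of "{..<d}"] lessThan_iff ..
  obtain e where e: "e > 0" and near: "\<forall>g' y. (\<forall>j\<in>X \<times> X. \<forall>k\<in>{..<d}. \<bar>g' j k - g p0 j k\<bar> < e) \<longrightarrow>
      (\<forall>j\<in>X \<times> X. (\<Sum>k\<in>{..<d}. y k * g' j k) = 0) \<longrightarrow> (\<forall>k\<in>{..<d}. y k = 0)"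
    using trivial_kernel_open[OF finite_cartesian_product[OF X X] finite_lessThan p0[unfolded spanning_iff]]
    by (elim exE conjE) (rule that)
  show ?thesis
  proof (rule exI[of _ "e / 2"], intro conjI allI impI)
    show "e / 2 > 0" using e by simp
    fix p assume p: "\<forall>v\<in>X. \<forall>k<d. \<bar>p v k - p0 v k\<bar> < e / 2"
    have "\<bar>g p j k - g p0 j k\<bar> < e" if "j \<in> X \<times> X" "k \<in> {..<d}" for j k
    proof -
      have "\<bar>p (fst j) k - p0 (fst j) k\<bar> < e / 2" "\<bar>p (snd j) k - p0 (snd j) k\<bar> < e / 2"
        using p that by auto
      then show ?thesis unfolding g_def by linarith
    qed
    then show "spanning d X p" unfolding spanning_iff using near by blast
  qed
qed

section \<open>Congruent placements and isometries\<close>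

text \<open>The two sides of Bessel's inequality for the standard basis have the same sum, the trace.\<close>

lemma orthonormal_rows_imp_orthonormal_columns:
  fixes a :: "nat \<Rightarrow> nat \<Rightarrow> real"
  assumes on: "\<And>i j. \<lbrakk>i < d; j < d\<rbrakk> \<Longrightarrow> (\<Sum>k<d. a i k * a j k) = (if i = j then 1 else 0)"
    and kl: "k < d" "l < d"
  shows "(\<Sum>i<d. a i k * a i l) = (if k = l then 1 else 0)"
proof -
  \<comment> \<open>\<open>c\<close> is the Gram matrix of the columns and \<open>r\<close> is the
    identity minus \<open>c\<close>. Orthonormal rows make \<open>c\<close> a projection of trace
    \<open>d\<close>, so the squared entries of \<open>r\<close> sum to
    \<open>d - d = 0\<close>.\<close>
  define c where "c k l = (\<Sum>i<d. a i k * a i l)" for k l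
  define r where "r k l = (if k = l then 1 else 0) - c k l" for k l :: nat
  have cc: "(\<Sum>l<d. c k l * c k l) = c k k" for k
  proof -
    have "(\<Sum>l<d. c k l * c k l) = (\<Sum>l<d. \<Sum>i<d. \<Sum>j<d. a i k * a j k * (a i l * a j l))"
      by (simp add: c_def sum_product mult_ac)
    also have "\<dots> = (\<Sum>i<d. \<Sum>l<d. \<Sum>j<d. a i k * a j k * (a i l * a j l))"
      by (rule sum.swap)
    also have "\<dots> = (\<Sum>i<d. \<Sum>j<d. \<Sum>l<d. a i k * a j k * (a i l * a j l))"
      by (rule sum.cong[OF refl], rule sum.swap)
    also have "\<dots> = (\<Sum>i<d. \<Sum>j<d. a i k * a j k * (if i = j then 1 else 0))"
      by (intro sum.cong refl) (simp add: sum_distrib_left[symmetric] on)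
    also have "\<dots> = (\<Sum>i<d. \<Sum>j<d. if i = j then a i k * a i k else 0)"
      by (intro sum.cong refl) auto
    also have "\<dots> = c k k"
      by (simp add: c_def)
    finally show ?thesis .
  qed
  have rr: "(\<Sum>l<d. (r k l)\<^sup>2) = 1 - c k k" if "k < d" for k
  proof -
    have "(r k l)\<^sup>2 = (if k = l then 1 - 2 * c k k else 0) + c k l * c k l" for l
      by (auto simp: r_def power2_eq_square algebra_simps)
    then have "(\<Sum>l<d. (r k l)\<^sup>2) = (\<Sum>l<d. if k = l then 1 - 2 * c k k else 0) + (\<Sum>l<d. c k l * c k l)"
      by (simp add: sum.distrib)
    then show ?thesis using that by (simp add: cc)
  qed
  have "(\<Sum>k<d. c k k) = (\<Sum>i<d. \<Sum>k<d. a i k * a i k)"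
    unfolding c_def by (rule sum.swap)
  also have "\<dots> = real d" by (simp add: on)
  finally have "(\<Sum>k<d. \<Sum>l<d. (r k l)\<^sup>2) = 0" by (simp add: rr sum_subtractf)
  then have "\<forall>k\<in>{..<d}. (\<Sum>l<d. (r k l)\<^sup>2) = 0"
    by (subst (asm) sum_nonneg_eq_0_iff) (auto intro: sum_nonneg)
  then have "(\<Sum>l<d. (r k l)\<^sup>2) = 0" using kl by simp
  then have "r k l = 0" using kl by (simp add: sum_nonneg_eq_0_iff)
  then show ?thesis by (simp add: r_def c_def)
qed

lemma orthonormal_rows_isometry:
  fixes a :: "nat \<Rightarrow> nat \<Rightarrow> real"
  assumes on: "\<And>i j. \<lbrakk>i < d; j < d\<rbrakk> \<Longrightarrow> (\<Sum>k<d. a i k * a j k) = (if i = j then 1 else 0)"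
  shows "(\<Sum>i<d. (\<Sum>k<d. a i k * x k)\<^sup>2) = (\<Sum>k<d. (x k)\<^sup>2)"
proof -
  have "(\<Sum>i<d. (\<Sum>k<d. a i k * x k)\<^sup>2) = (\<Sum>i<d. \<Sum>k<d. \<Sum>l<d. x k * x l * (a i k * a i l))"
    by (simp add: power2_eq_square sum_product mult_ac)
  also have "\<dots> = (\<Sum>k<d. \<Sum>i<d. \<Sum>l<d. x k * x l * (a i k * a i l))"
    by (rule sum.swap)
  also have "\<dots> = (\<Sum>k<d. \<Sum>l<d. \<Sum>i<d. x k * x l * (a i k * a i l))"
    by (rule sum.cong[OF refl], rule sum.swap)
  also have "\<dots> = (\<Sum>k<d. \<Sum>l<d. if k = l then x k * x k else 0)"
    by (intro sum.cong refl)
      (auto simp: sum_distrib_left[symmetric] orthonormal_rows_imp_orthonormal_columns[OF on])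
  finally show ?thesis by (simp add: power2_eq_square)
qed

text \<open>By polarization, equal distances give equal inner products of differences. Each unit
  vector is a combination of differences of \<open>p\<close>, and the same combination of
  differences of \<open>p'\<close> is a row of \<open>a\<close>. Equality of inner products makes
  these rows orthonormal and makes \<open>a\<close> carry differences of \<open>p'\<close> to those
  of \<open>p\<close>.\<close>

lemma congruent_imp_isometry:
  assumes X: "finite X" and span: "spanning d X p"
    and cong: "\<forall>u\<in>X. \<forall>v\<in>X. sq_dist d (p' u) (p' v) = sq_dist d (p u) (p v)"
  shows "\<exists>a. (\<forall>i<d. \<forall>j<d. (\<Sum>k<d. a i k * a j k) = (if i = j then 1 else 0)) \<and>
    (\<forall>i<d. \<forall>u\<in>X. \<forall>v\<in>X. (\<Sum>k<d. a i k * (p' u k - p' v k)) = p u i - p v i)"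
proof -
  define ip where "ip p j m = (\<Sum>k<d. (p (fst j) k - p (snd j) k) * (p (fst m) k - p (snd m) k))"
    for p :: "'a \<Rightarrow> nat \<Rightarrow> real" and j m
  have polar: "2 * ip p j m = sq_dist d (p (fst j)) (p (snd m)) + sq_dist d (p (snd j)) (p (fst m))
      - sq_dist d (p (fst j)) (p (fst m)) - sq_dist d (p (snd j)) (p (snd m))" for p j m
    unfolding ip_def sq_dist_def sum.distrib[symmetric] sum_subtractf[symmetric] sum_distrib_left
    by (intro sum.cong refl) (simp add: power2_eq_square algebra_simps)
  have ip: "ip p' j m = ip p j m" if "j \<in> X \<times> X" "m \<in> X \<times> X" for j m
  proof -
    have "2 * ip p' j m = 2 * ip p j m"
      unfolding polar using that by (auto simp: cong)
    then show ?thesis by simp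
  qed
  have ker: "\<forall>y. (\<forall>j\<in>X \<times> X. (\<Sum>k\<in>{..<d}. y k * (p (fst j) k - p (snd j) k)) = 0) \<longrightarrow> (\<forall>k\<in>{..<d}. y k = 0)"
    using span unfolding spanning_def Ball_def by simp
  have "\<forall>i. \<exists>b. \<forall>k\<in>{..<d}. (if k = i then 1 else 0) = (\<Sum>j\<in>X \<times> X. b j * (p (fst j) k - p (snd j) k))"
    by (rule allI, rule trivial_kernel_imp_span[OF finite_cartesian_product[OF X X] finite_lessThan ker])
  from choice[OF this] obtain b where
    b: "\<And>i k. k < d \<Longrightarrow> (\<Sum>j\<in>X \<times> X. b i j * (p (fst j) k - p (snd j) k)) = (if k = i then 1 else 0)"
    by auto
  define a where "a i k = (\<Sum>j\<in>X \<times> X. b i j * (p' (fst j) k - p' (snd j) k))" for i k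
  have a: "(\<Sum>k<d. a i k * (p' u k - p' v k)) = p u i - p v i" if i: "i < d" and uv: "u \<in> X" "v \<in> X" for i u v
  proof -
    have exch: "(\<Sum>k<d. (\<Sum>j\<in>X \<times> X. b i j * (p (fst j) k - p (snd j) k)) * (p u k - p v k))
        = (\<Sum>j\<in>X \<times> X. b i j * ip p j (u, v))" for p
    proof -
      have "(\<Sum>k<d. (\<Sum>j\<in>X \<times> X. b i j * (p (fst j) k - p (snd j) k)) * (p u k - p v k))
          = (\<Sum>k<d. \<Sum>j\<in>X \<times> X. b i j * ((p (fst j) k - p (snd j) k) * (p u k - p v k)))"
        unfolding sum_distrib_right by (intro sum.cong refl) (simp add: mult_ac)
      also have "\<dots> = (\<Sum>j\<in>X \<times> X. \<Sum>k<d. b i j * ((p (fst j) k - p (snd j) k) * (p u k - p v k)))"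
        by (rule sum.swap)
      finally show ?thesis by (simp add: ip_def sum_distrib_left)
    qed
    have "(\<Sum>k<d. a i k * (p' u k - p' v k)) = (\<Sum>j\<in>X \<times> X. b i j * ip p j (u, v))"
      unfolding a_def exch using uv by (intro sum.cong refl) (simp add: ip)
    also have "\<dots> = (\<Sum>k<d. (if k = i then 1 else 0) * (p u k - p v k))"
      unfolding exch[symmetric] by (intro sum.cong refl) (simp add: b)
    also have "\<dots> = (\<Sum>k<d. if k = i then p u i - p v i else 0)"
      by (intro sum.cong refl) auto
    also have "\<dots> = p u i - p v i" using i by simp
    finally show ?thesis .
  qed
  have "(\<Sum>k<d. a i k * a j k) = (if i = j then 1 else 0)" if ij: "i < d" "j < d" for i j
  proof -
    have "(\<Sum>k<d. a i k * a j k) = (\<Sum>k<d. \<Sum>m\<in>X \<times> X. b j m * (a i k * (p' (fst m) k - p' (snd m) k)))"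
      by (simp add: a_def[of j] sum_distrib_left mult_ac)
    also have "\<dots> = (\<Sum>m\<in>X \<times> X. b j m * (\<Sum>k<d. a i k * (p' (fst m) k - p' (snd m) k)))"
      by (subst sum.swap) (simp add: sum_distrib_left)
    also have "\<dots> = (\<Sum>m\<in>X \<times> X. b j m * (p (fst m) i - p (snd m) i))"
      using ij by (intro sum.cong refl) (auto simp: a)
    finally show ?thesis using b[OF ij(1)] by simp
  qed
  then show ?thesis using a by (intro exI[of _ a]) blast
qed

section \<open>From infinitesimal rigidity to rigidity\<close>

text \<open>The difference of two placements with equal edge lengths is a flex of their midpoint.\<close>

lemma inf_rigid_midpoint_imp_congruent:
  assumes rigid: "inf_rigid d E X (\<lambda>v k. (p v k + p' v k) / 2)"
    and edges: "\<And>u v. \<lbrakk>u \<in> X; v \<in> X; E u v\<rbrakk> \<Longrightarrow> sq_dist d (p' u) (p' v) = sq_dist d (p u) (p v)"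
    and uv: "u \<in> X" "v \<in> X"
  shows "sq_dist d (p' u) (p' v) = sq_dist d (p u) (p v)"
proof -
  let ?m = "\<lambda>v k. (p v k + p' v k) / 2" and ?q = "\<lambda>v k. p' v k - p v k"
  have *: "2 * (\<Sum>k<d. (?q u k - ?q v k) * (?m u k - ?m v k)) = sq_dist d (p' u) (p' v) - sq_dist d (p u) (p v)" for u v
    unfolding sq_dist_def sum_subtractf[symmetric] sum_distrib_left
    by (intro sum.cong refl) (simp add: power2_eq_square field_simps)
  have "edge_flex d E X ?m ?q"
    unfolding edge_flex_def
  proof (intro ballI impI)
    fix u v assume "u \<in> X" "v \<in> X" "E u v"
    then show "(\<Sum>k<d. (?q u k - ?q v k) * (?m u k - ?m v k)) = 0"
      using *[of u v] edges[of u v] by linarith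
  qed
  then have "trivial_flex d X ?m ?q" using rigid by (simp add: inf_rigid_def)
  \<comment> \<open>A trivial flex satisfies the first-order condition on all pairs, so the identity
    above can be read backwards for non-edges as well.\<close>
  then have "edge_flex d (\<lambda>_ _. True) X ?m ?q" by (rule trivial_flex_imp_edge_flex)
  then have "(\<Sum>k<d. (?q u k - ?q v k) * (?m u k - ?m v k)) = 0"
    using uv unfolding edge_flex_def by blast
  then show ?thesis using *[of u v] by linarith
qed

text \<open>The times at which all distances have their initial values form a closed set containing
  0. It is also open: an isometry carries the configuration at such a time back to \<open>p\<close>,
  and nearby configurations, moved by the same isometry, have a midpoint with \<open>p\<close>
  inside the neighbourhood. Connectedness of the unit interval finishes the proof.\<close>

lemma inf_rigid_nbhd_imp_rigid:
  fixes P :: "real \<Rightarrow> 'a \<Rightarrow> nat \<Rightarrow> real"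
  assumes X: "finite X" and span: "spanning d X p" and e: "e > 0"
    and nbhd: "\<And>p'. \<forall>v\<in>X. \<forall>k<d. \<bar>p' v k - p v k\<bar> < e \<Longrightarrow> inf_rigid d E X p'"
    and cont: "\<And>v k. \<lbrakk>v \<in> X; k < d\<rbrakk> \<Longrightarrow> continuous_on {0..1} (\<lambda>t. P t v k)"
    and start: "\<And>v k. \<lbrakk>v \<in> X; k < d\<rbrakk> \<Longrightarrow> P 0 v k = p v k"
    and edges: "\<And>t u v. \<lbrakk>t \<in> {0..1}; u \<in> X; v \<in> X; E u v\<rbrakk> \<Longrightarrow> sq_dist d (P t u) (P t v) = sq_dist d (p u) (p v)"
    and t: "t \<in> {0..1}" and uv: "u \<in> X" "v \<in> X"
  shows "sq_dist d (P t u) (P t v) = sq_dist d (p u) (p v)"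
proof -
  \<comment> \<open>Summing squares over all pairs makes the set of good times the zero set of one
    continuous function.\<close>
  define F where "F t = (\<Sum>j\<in>X \<times> X. (sq_dist d (P t (fst j)) (P t (snd j)) - sq_dist d (p (fst j)) (p (snd j)))\<^sup>2)" for t
  have F_iff: "F t = 0 \<longleftrightarrow> (\<forall>u\<in>X. \<forall>v\<in>X. sq_dist d (P t u) (P t v) = sq_dist d (p u) (p v))" for t
    unfolding F_def using X by (subst sum_nonneg_eq_0_iff) auto
  define D where "D = {t \<in> {0..1}. F t = 0}"
  have "continuous_on {0..1} F"
    unfolding F_def sq_dist_def by (intro continuous_intros cont) auto
  then have closed: "closedin (top_of_set {0..1}) D"
    unfolding D_def by (rule continuous_closedin_preimage_constant)
  have "openin (top_of_set {0..1}) D"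
    unfolding openin_euclidean_subtopology_iff
  proof (intro conjI ballI)
    show "D \<subseteq> {0..1}" by (auto simp: D_def)
    fix t0 assume t0: "t0 \<in> D"
    have "\<forall>u\<in>X. \<forall>v\<in>X. sq_dist d (P t0 u) (P t0 v) = sq_dist d (p u) (p v)"
      using t0 F_iff by (auto simp: D_def)
    from congruent_imp_isometry[OF X span this] obtain a where
      on': "\<forall>i<d. \<forall>j<d. (\<Sum>k<d. a i k * a j k) = (if i = j then 1 else 0)"
      and a': "\<forall>i<d. \<forall>u\<in>X. \<forall>v\<in>X. (\<Sum>k<d. a i k * (P t0 u k - P t0 v k)) = p u i - p v i"
      by (elim exE conjE) (rule that)
    have on: "(\<Sum>k<d. a i k * a j k) = (if i = j then 1 else 0)" if "i < d" "j < d" for i j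
      using on' that by blast
    have a: "(\<Sum>k<d. a i k * (P t0 u k - P t0 v k)) = p u i - p v i"
      if "i < d" "u \<in> X" "v \<in> X" for i u v
      using a' that by blast
    \<comment> \<open>The motion seen through the isometry that takes the configuration at time
      \<open>t0\<close> to \<open>p\<close>, with \<open>v\<close> as base point.\<close>
    define r where "r t w i = p v i + (\<Sum>k<d. a i k * (P t w k - P t0 v k))" for t w i
    have r0: "r t0 w i = p w i" if "w \<in> X" "i < d" for w i
      using that uv by (simp add: r_def a)
    have iso: "sq_dist d (r t w) (r t w') = sq_dist d (P t w) (P t w')" for t w w'
    proof -
      have "r t w i - r t w' i = (\<Sum>k<d. a i k * (P t w k - P t w' k))" for i
        by (simp add: r_def right_diff_distrib sum_subtractf)
      then show ?thesis
        unfolding sq_dist_def by (simp add: orthonormal_rows_isometry[OF on])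
    qed
    have cr: "continuous_on {0..1} (\<lambda>t. r t w i)" if "w \<in> X" for w i
      unfolding r_def by (intro continuous_intros cont that) auto
    have "\<forall>\<^sub>F t in at t0 within {0..1}. \<bar>r t w i - p w i\<bar> < e" if wi: "w \<in> X" "i < d" for w i
    proof -
      have "((\<lambda>t. r t w i) \<longlongrightarrow> r t0 w i) (at t0 within {0..1})"
        using cr[OF wi(1)] t0 by (simp add: continuous_on_def D_def)
      from tendstoD[OF this e] show ?thesis by (simp add: dist_real_def r0[OF wi])
    qed
    then have "\<forall>\<^sub>F t in at t0 within {0..1}. \<forall>w\<in>X. \<forall>i\<in>{..<d}. \<bar>r t w i - p w i\<bar> < e"
      using X by (intro eventually_ball_finite ballI finite_lessThan) auto
    then obtain \<delta> where \<delta>: "\<delta> > 0"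
      and near: "\<And>t. \<lbrakk>t \<in> {0..1}; t \<noteq> t0; dist t t0 < \<delta>\<rbrakk> \<Longrightarrow> \<forall>w\<in>X. \<forall>i\<in>{..<d}. \<bar>r t w i - p w i\<bar> < e"
      unfolding eventually_at by blast
    have "t \<in> D" if t: "t \<in> {0..1}" "dist t t0 < \<delta>" for t
    proof (cases "t = t0")
      case False
      have "inf_rigid d E X (\<lambda>w k. (p w k + r t w k) / 2)"
      proof (rule nbhd, intro ballI allI impI)
        fix w k assume "w \<in> X" "k < d"
        then have "\<bar>r t w k - p w k\<bar> < e" using near[OF t(1) False t(2)] by auto
        then show "\<bar>(p w k + r t w k) / 2 - p w k\<bar> < e" by (simp add: field_simps abs_if split: if_splits)
      qed
      then have "sq_dist d (r t w) (r t w') = sq_dist d (p w) (p w')" if "w \<in> X" "w' \<in> X" for w w'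
        by (rule inf_rigid_midpoint_imp_congruent) (use edges[OF t(1)] that in \<open>auto simp: iso\<close>)
      then show ?thesis using t F_iff by (auto simp: D_def iso)
    qed (use t0 in simp)
    then show "\<exists>\<delta>>0. \<forall>t\<in>{0..1}. dist t t0 < \<delta> \<longrightarrow> t \<in> D" using \<delta> by blast
  qed
  moreover have "sq_dist d (P 0 u) (P 0 v) = sq_dist d (p u) (p v)" if "u \<in> X" "v \<in> X" for u v
    using that by (simp add: sq_dist_def start)
  then have "0 \<in> D" by (auto simp: D_def F_iff)
  ultimately have "D = {0..1}"
    using closed connected_Icc[of 0 "1::real"] unfolding connected_clopen by blast
  with t have "t \<in> D" by blast
  then have "F t = 0" unfolding D_def by blast
  then show ?thesis using uv F_iff by blast
qed


section \<open>Density of generic points\<close>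

lemma rat_mpoly_eval_superset:
  assumes "finite I" "\<forall>m\<in>Poly_Mapping.keys f. Poly_Mapping.keys m \<subseteq> I"
  shows "rat_mpoly_eval x f = (\<Sum>m\<in>Poly_Mapping.keys f. of_rat (Poly_Mapping.lookup f m) *
    (\<Prod>i\<in>I. x i ^ Poly_Mapping.lookup m i))"
  unfolding rat_mpoly_eval_def
proof (intro sum.cong refl)
  fix m assume "m \<in> Poly_Mapping.keys f"
  then have "(\<Prod>i\<in>Poly_Mapping.keys m. x i ^ Poly_Mapping.lookup m i) = (\<Prod>i\<in>I. x i ^ Poly_Mapping.lookup m i)"
    using assms by (intro prod.mono_neutral_left) (auto simp: in_keys_iff)
  then show "of_rat (Poly_Mapping.lookup f m) * (\<Prod>i\<in>Poly_Mapping.keys m. x i ^ Poly_Mapping.lookup m i)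
      = of_rat (Poly_Mapping.lookup f m) * (\<Prod>i\<in>I. x i ^ Poly_Mapping.lookup m i)"
    by simp
qed

text \<open>Monomials embed into the functions from the finite set \<open>I\<close> to the naturals,
  and a polynomial is determined by the finite graph of its nonzero coefficients.\<close>

lemma countable_mpoly_over_finite:
  assumes I: "finite I"
  shows "countable {f :: ('i \<Rightarrow>\<^sub>0 nat) \<Rightarrow>\<^sub>0 rat. \<forall>m\<in>Poly_Mapping.keys f. Poly_Mapping.keys m \<subseteq> I}"
proof -
  define M where "M = {m :: 'i \<Rightarrow>\<^sub>0 nat. Poly_Mapping.keys m \<subseteq> I}"
  have "inj_on (\<lambda>m. restrict (Poly_Mapping.lookup m) I) M"
  proof (rule inj_onI, rule poly_mapping_eqI)
    fix m m' :: "'i \<Rightarrow>\<^sub>0 nat" and i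
    assume m: "m \<in> M" "m' \<in> M"
      and eq: "restrict (Poly_Mapping.lookup m) I = restrict (Poly_Mapping.lookup m') I"
    show "Poly_Mapping.lookup m i = Poly_Mapping.lookup m' i"
    proof (cases "i \<in> I")
      case True
      then show ?thesis using fun_cong[OF eq, of i] by simp
    next
      case False
      then have "i \<notin> Poly_Mapping.keys m" "i \<notin> Poly_Mapping.keys m'" using m by (auto simp: M_def)
      then show ?thesis by (simp add: in_keys_iff)
    qed
  qed
  moreover have "(\<lambda>m. restrict (Poly_Mapping.lookup m) I) ` M \<subseteq> PiE I (\<lambda>_. UNIV)"
    by auto
  then have "countable ((\<lambda>m. restrict (Poly_Mapping.lookup m) I) ` M)"
    by (rule countable_subset) (intro countable_PiE I, simp)
  ultimately have M: "countable M" by (rule countable_image_inj_on[rotated])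
  define graph_of where "graph_of f = (\<lambda>m. (m, Poly_Mapping.lookup f m)) ` Poly_Mapping.keys f"
    for f :: "('i \<Rightarrow>\<^sub>0 nat) \<Rightarrow>\<^sub>0 rat"
  let ?P = "{f :: ('i \<Rightarrow>\<^sub>0 nat) \<Rightarrow>\<^sub>0 rat. Poly_Mapping.keys f \<subseteq> M}"
  have "inj_on graph_of ?P"
  proof (rule inj_onI, rule poly_mapping_eqI)
    fix f g :: "('i \<Rightarrow>\<^sub>0 nat) \<Rightarrow>\<^sub>0 rat" and m
    assume eq: "graph_of f = graph_of g"
    have *: "(m, c) \<in> graph_of f \<longleftrightarrow> c \<noteq> 0 \<and> Poly_Mapping.lookup f m = c" for f c
      by (auto simp: graph_of_def in_keys_iff)
    show "Poly_Mapping.lookup f m = Poly_Mapping.lookup g m"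
      using eq *[of _ f] *[of _ g] by metis
  qed
  moreover have "graph_of ` ?P \<subseteq> {A. finite A \<and> A \<subseteq> M \<times> UNIV}"
    by (auto simp: graph_of_def)
  then have "countable (graph_of ` ?P)"
    by (rule countable_subset) (intro countable_Collect_finite_subset countable_SIGMA M, simp)
  ultimately have "countable ?P" by (rule countable_image_inj_on[rotated])
  then show ?thesis by (simp add: M_def subset_eq)
qed

text \<open>Collecting powers of \<open>x i\<close>, some coefficient is a nonzero polynomial in the other
  variables, so the value is a nonzero real polynomial in \<open>x i\<close>.\<close>

lemma finite_roots_in_new_variable:
  assumes I: "finite I" and i: "i \<notin> I"
    and ind: "algebraically_independent_over_rat I x"
    and f0: "f \<noteq> 0" and f: "\<forall>m\<in>Poly_Mapping.keys f. Poly_Mapping.keys m \<subseteq> insert i I"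
  shows "finite {z. rat_mpoly_eval (x(i := z)) f = 0}"
proof -
  let ?lk = Poly_Mapping.lookup and ?ks = Poly_Mapping.keys
  \<comment> \<open>\<open>K e\<close> collects the monomials of degree \<open>e\<close> in the new
    variable \<open>i\<close>, and \<open>drop\<close> erases that variable. It is injective on each
    \<open>K e\<close>, so no terms cancel.\<close>
  define K where "K e = {m \<in> ?ks f. ?lk m i = e}" for e
  define drop where "drop m = Poly_Mapping.update i 0 m" for m :: "'a \<Rightarrow>\<^sub>0 nat"
  have lk_drop: "?lk (drop m) j = (if j = i then 0 else ?lk m j)" for m j
    by (simp add: drop_def lookup_update)
  have inj: "inj_on drop (K e)" for e
  proof (rule inj_onI, rule poly_mapping_eqI)
    fix m m' j assume "m \<in> K e" "m' \<in> K e" "drop m = drop m'"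
    then show "?lk m j = ?lk m' j"
      using lk_drop[of m j] lk_drop[of m' j] by (cases "j = i") (auto simp: K_def)
  qed
  define c where "c e = (\<Sum>m\<in>K e. of_rat (?lk f m) * (\<Prod>j\<in>I. x j ^ ?lk m j))" for e
  obtain m0 where m0: "m0 \<in> ?ks f" using f0 by (metis ex_in_conv keys_eq_empty)
  define e0 where "e0 = ?lk m0 i"
  have c0: "c e0 \<noteq> 0"
  proof -
    \<comment> \<open>The coefficient of the power \<open>e0\<close> of variable \<open>i\<close>,
      as a polynomial over \<open>I\<close>. It contains the erased \<open>m0\<close>, so it is
      nonzero and independence applies; its value at \<open>x\<close> is
      \<open>c e0\<close>.\<close>
    define g where "g = (\<Sum>m\<in>K e0. Poly_Mapping.single (drop m) (?lk f m))"
    have lk_g: "?lk g (drop m) = ?lk f m" if "m \<in> K e0" for m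
    proof -
      have "?lk g (drop m) = (\<Sum>m'\<in>K e0. if m = m' then ?lk f m' else 0)"
        unfolding g_def lookup_sum
        by (intro sum.cong refl) (use inj_onD[OF inj] that in \<open>auto simp: lookup_single when_def\<close>)
      then show ?thesis using that by (simp add: K_def)
    qed
    have keys_g: "?ks g \<subseteq> drop ` K e0"
      unfolding g_def by (rule order_trans[OF keys_sum]) (auto split: if_splits)
    have sub: "\<forall>m\<in>?ks g. ?ks m \<subseteq> I"
    proof
      fix m assume "m \<in> ?ks g"
      then obtain m' where m': "m = drop m'" "m' \<in> ?ks f" using keys_g by (auto simp: K_def)
      show "?ks m \<subseteq> I"
      proof
        fix j assume "j \<in> ?ks m"
        then have "j \<noteq> i" "j \<in> ?ks m'"
          using lk_drop[of m' j] m'(1) by (auto simp: in_keys_iff split: if_splits)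
        then show "j \<in> I" using f m'(2) by blast
      qed
    qed
    have "m0 \<in> K e0" using m0 by (simp add: K_def e0_def)
    then have "?lk g (drop m0) \<noteq> 0" using lk_g m0 by (simp add: in_keys_iff)
    then have "g \<noteq> 0" by auto
    then have "rat_mpoly_eval x g \<noteq> 0"
      using ind sub by (auto simp: algebraically_independent_over_rat_def)
    also have "rat_mpoly_eval x g = (\<Sum>m\<in>drop ` K e0. of_rat (?lk g m) * (\<Prod>j\<in>I. x j ^ ?lk m j))"
      unfolding rat_mpoly_eval_superset[OF I sub]
      by (intro sum.mono_neutral_left keys_g) (auto simp: K_def in_keys_iff)
    also have "\<dots> = (\<Sum>m\<in>K e0. of_rat (?lk g (drop m)) * (\<Prod>j\<in>I. x j ^ ?lk (drop m) j))"
      by (rule sum.reindex_cong[OF inj]) auto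
    also have "\<dots> = c e0"
      unfolding c_def
    proof (intro sum.cong refl arg_cong2[where f = "(*)"] prod.cong)
      fix m j assume "j \<in> I"
      then show "x j ^ ?lk (drop m) j = x j ^ ?lk m j" using i by (auto simp: lk_drop)
    qed (simp add: lk_g)
    finally show ?thesis .
  qed
  define p where "p = (\<Sum>e\<in>(\<lambda>m. ?lk m i) ` ?ks f. monom (c e) e)"
  have "coeff p e0 = c e0"
    using m0 by (simp add: p_def coeff_sum e0_def)
  then have "p \<noteq> 0" using c0 by auto
  moreover have "rat_mpoly_eval (x(i := z)) f = poly p z" for z
  proof -
    have "rat_mpoly_eval (x(i := z)) f = (\<Sum>m\<in>?ks f. of_rat (?lk f m) * (z ^ ?lk m i * (\<Prod>j\<in>I. x j ^ ?lk m j)))"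
    proof -
      have "(\<Prod>j\<in>I. (x(i := z)) j ^ ?lk m j) = (\<Prod>j\<in>I. x j ^ ?lk m j)" for m
        using i by (intro prod.cong) auto
      then show ?thesis
        unfolding rat_mpoly_eval_superset[OF finite.insertI[OF I] f] using I i by simp
    qed
    also have "\<dots> = (\<Sum>e\<in>(\<lambda>m. ?lk m i) ` ?ks f. \<Sum>m\<in>K e. of_rat (?lk f m) * (z ^ ?lk m i * (\<Prod>j\<in>I. x j ^ ?lk m j)))"
      unfolding K_def by (rule sum.image_gen) simp
    also have "\<dots> = (\<Sum>e\<in>(\<lambda>m. ?lk m i) ` ?ks f. c e * z ^ e)"
      unfolding c_def sum_distrib_right by (intro sum.cong refl) (auto simp: K_def)
    also have "\<dots> = poly p z"
      by (simp add: p_def poly_sum poly_monom)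
    finally show ?thesis .
  qed
  ultimately show ?thesis by (simp add: poly_roots_finite)
qed

text \<open>Coordinates are chosen one at a time. Each of the countably many rational polynomials
  forbids finitely many values of the new coordinate, and an open interval is uncountable.\<close>

lemma algebraically_independent_dense:
  assumes "finite I" and e: "e > 0"
  shows "\<exists>x. algebraically_independent_over_rat I x \<and> (\<forall>i\<in>I. \<bar>x i - x0 i\<bar> < e)"
  using \<open>finite I\<close>
proof (induction I rule: finite_induct)
  case empty
  \<comment> \<open>A nonzero polynomial without variables is a nonzero constant.\<close>
  have "rat_mpoly_eval x f \<noteq> 0" if "f \<noteq> 0" "\<forall>m\<in>Poly_Mapping.keys f. Poly_Mapping.keys m \<subseteq> {}" for x f
  proof -
    have "Poly_Mapping.keys f \<subseteq> {0}" using that by auto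
    moreover have "Poly_Mapping.keys f \<noteq> {}" using that(1) by simp
    ultimately have "Poly_Mapping.keys f = {0}" by blast
    then show ?thesis using in_keys_iff[of 0 f] by (simp add: rat_mpoly_eval_def)
  qed
  then have "algebraically_independent_over_rat {} x0"
    unfolding algebraically_independent_over_rat_def by blast
  then show ?case by blast
next
  case (insert i I)
  obtain x where x: "algebraically_independent_over_rat I x" "\<forall>i\<in>I. \<bar>x i - x0 i\<bar> < e"
    using insert.IH by blast
  define F where "F = {f :: ('a \<Rightarrow>\<^sub>0 nat) \<Rightarrow>\<^sub>0 rat. \<forall>m\<in>Poly_Mapping.keys f. Poly_Mapping.keys m \<subseteq> insert i I}"
  have "countable (\<Union>f\<in>F - {0}. {z. rat_mpoly_eval (x(i := z)) f = 0})"
  proof (intro countable_UN)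
    show "countable (F - {0})"
      unfolding F_def by (intro countable_Diff countable_mpoly_over_finite) (simp add: insert.hyps)
    show "countable {z. rat_mpoly_eval (x(i := z)) f = 0}" if "f \<in> F - {0}" for f
      using that x(1) insert.hyps
      by (intro countable_finite finite_roots_in_new_variable[of I]) (auto simp: F_def)
  qed
  moreover have "uncountable {x0 i - e <..< x0 i + e}"
    using e by (simp add: uncountable_open_interval)
  ultimately have "\<not> {x0 i - e <..< x0 i + e} \<subseteq> (\<Union>f\<in>F - {0}. {z. rat_mpoly_eval (x(i := z)) f = 0})"
    using countable_subset by blast
  then obtain z where z: "z \<in> {x0 i - e <..< x0 i + e}"
    "z \<notin> (\<Union>f\<in>F - {0}. {z. rat_mpoly_eval (x(i := z)) f = 0})"
    by blast
  have "algebraically_independent_over_rat (insert i I) (x(i := z))"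
    using z(2) unfolding algebraically_independent_over_rat_def F_def by blast
  moreover have "\<forall>j\<in>insert i I. \<bar>(x(i := z)) j - x0 j\<bar> < e"
    using z(1) x(2) insert.hyps by (auto simp: abs_less_iff)
  ultimately show ?case by blast
qed


section \<open>Frameworks with coincident points\<close>

lemma edge_flex_subset: "\<lbrakk>edge_flex d E Y p q; X \<subseteq> Y\<rbrakk> \<Longrightarrow> edge_flex d E X p q"
  unfolding edge_flex_def by blast

lemma inf_rigid_cong:
  assumes "\<And>v. v \<in> X \<Longrightarrow> p v = p' v" and p: "inf_rigid d E X p"
  shows "inf_rigid d E X p'"
  unfolding inf_rigid_def
proof (intro allI impI)
  fix q assume "edge_flex d E X p' q"
  then have "edge_flex d E X p q" using assms(1) by (simp add: edge_flex_def)
  then have "trivial_flex d X p q" using p by (simp add: inf_rigid_def)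
  then obtain S t where S: "\<forall>k<d. \<forall>l<d. S k l = - S l k"
    and q: "\<forall>v\<in>X. \<forall>k<d. q v k = t k + (\<Sum>l<d. S k l * p v l)"
    unfolding trivial_flex_def by blast
  have "\<forall>v\<in>X. \<forall>k<d. q v k = t k + (\<Sum>l<d. S k l * p' v l)"
    using q assms(1) by simp
  with S show "trivial_flex d X p' q" unfolding trivial_flex_def by blast
qed

text \<open>Normalise \<open>q\<close> to vanish at point \<open>0\<close>, which is the origin. The
  pair of \<open>i\<close> and \<open>0\<close> makes \<open>r i\<close> orthogonal to
  \<open>L i\<close>; the pair of \<open>i\<close> and \<open>Suc k\<close> then expresses
  coordinate \<open>k\<close> of \<open>r i\<close> linearly in \<open>L i\<close>. Taking unit
  vectors for \<open>L i\<close> shows that the matrix is skew.\<close>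

lemma complete_framework_flex_trivial:
  fixes L q :: "nat \<Rightarrow> nat \<Rightarrow> real"
  assumes L0: "\<And>k. k < d \<Longrightarrow> L 0 k = 0"
    and L1: "\<And>i k. \<lbrakk>i < d; k < d\<rbrakk> \<Longrightarrow> L (Suc i) k = (if i = k then 1 else 0)"
    and M: "d < M"
    and q: "\<And>i j. \<lbrakk>i < M; j < M; i \<noteq> j\<rbrakk> \<Longrightarrow> (\<Sum>k<d. (q i k - q j k) * (L i k - L j k)) = 0"
  shows "trivial_flex d {..<M} L q"
proof -
  define r where "r i k = q i k - q 0 k" for i k
  have r: "(\<Sum>k<d. (r i k - r j k) * (L i k - L j k)) = 0" if "i < M" "j < M" for i j
    using q[of i j] that by (cases "i = j") (simp_all add: r_def)
  have r0: "(\<Sum>m<d. r i m * L i m) = 0" if "i < M" for i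
    using r[of i 0] that L0 by (simp add: r_def)
  have pick: "(\<Sum>m<d. f m * L (Suc k) m) = f k" if "k < d" for f :: "nat \<Rightarrow> real" and k
  proof -
    have "(\<Sum>m<d. f m * L (Suc k) m) = (\<Sum>m<d. if k = m then f k else 0)"
      using that by (intro sum.cong) (auto simp: L1)
    then show ?thesis using that by simp
  qed
  have rkk: "r (Suc k) k = 0" if "k < d" for k
    using r0[of "Suc k"] pick[OF that, of "r (Suc k)"] that M by simp
  have key: "r i k = - (\<Sum>m<d. r (Suc k) m * L i m)" if i: "i < M" and k: "k < d" for i k
  proof -
    have "0 = (\<Sum>m<d. (r i m - r (Suc k) m) * (L i m - L (Suc k) m))"
      using r[of i "Suc k"] i k M by simp
    also have "\<dots> = (\<Sum>m<d. r i m * L i m) - (\<Sum>m<d. r i m * L (Suc k) m)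
        - (\<Sum>m<d. r (Suc k) m * L i m) + (\<Sum>m<d. r (Suc k) m * L (Suc k) m)"
      unfolding sum.distrib[symmetric] sum_subtractf[symmetric]
      by (intro sum.cong refl) (simp add: algebra_simps)
    finally show ?thesis by (simp add: r0[OF i] pick[OF k] rkk[OF k])
  qed
  have skew: "r (Suc l) k = - r (Suc k) l" if "k < d" "l < d" for k l
    using key[of "Suc l" k] pick[OF that(2), of "r (Suc k)"] that M by simp
  show ?thesis
    unfolding trivial_flex_def
  proof (rule exI[of _ "\<lambda>k l. r (Suc l) k"], rule exI[of _ "q 0"], intro conjI allI ballI impI)
    fix k l assume "k < d" "l < d"
    then show "r (Suc l) k = - r (Suc k) l" by (rule skew)
  next
    fix i k assume i: "i \<in> {..<M}" and k: "k < d"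
    have "r i k = (\<Sum>l<d. r (Suc l) k * L i l)"
      unfolding key[OF i[unfolded lessThan_iff] k] sum_negf[symmetric]
      by (intro sum.cong refl) (simp add: skew[OF k])
    then show "q i k = q 0 k + (\<Sum>l<d. r (Suc l) k * L i l)" by (simp add: r_def)
  qed
qed

text \<open>Subtracting the trivial motion that agrees with \<open>q\<close> on \<open>X\<close>
  leaves a flex that is zero on \<open>X\<close>. At \<open>v\<close> it is orthogonal to the
  differences with \<open>d\<close> distinct points, so general position makes it zero. Labels are
  counted rather than neighbours because vertices with equal labels coincide.\<close>

lemma inf_rigid_insert:
  fixes L :: "nat \<Rightarrow> nat \<Rightarrow> real" and c :: "'a \<Rightarrow> nat"
  assumes gp: "\<And>i J y. \<lbrakk>finite J; d \<le> card J; i \<notin> J; \<forall>j\<in>J. (\<Sum>k<d. y k * (L i k - L j k)) = 0\<rbrakk>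
       \<Longrightarrow> \<forall>k<d. y k = 0"
    and X: "finite X" and rigid: "inf_rigid d E X (\<lambda>v. L (c v))"
    and J: "d \<le> card (c ` {u \<in> X. E v u})" and cv: "c v \<notin> c ` X"
  shows "inf_rigid d E (insert v X) (\<lambda>v. L (c v))"
  unfolding inf_rigid_def
proof (intro allI impI)
  let ?p = "\<lambda>v. L (c v)"
  fix q assume q: "edge_flex d E (insert v X) ?p q"
  then have "edge_flex d E X ?p q" by (rule edge_flex_subset) auto
  then have "trivial_flex d X ?p q" using rigid by (simp add: inf_rigid_def)
  then obtain S t where S: "\<forall>k<d. \<forall>l<d. S k l = - S l k"
    and qX: "\<forall>v\<in>X. \<forall>k<d. q v k = t k + (\<Sum>l<d. S k l * ?p v l)"
    unfolding trivial_flex_def by blast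
  define r where "r v k = t k + (\<Sum>l<d. S k l * ?p v l)" for v k
  have "trivial_flex d (insert v X) ?p r"
    unfolding trivial_flex_def r_def using S by blast
  then have r: "edge_flex d E (insert v X) ?p r" by (rule trivial_flex_imp_edge_flex)
  have diff: "edge_flex d E (insert v X) ?p (\<lambda>v k. q v k - r v k)"
    using q r by (rule edge_flex_diff)
  have rX: "r u k = q u k" if "u \<in> X" "k < d" for u k
    using qX that by (simp add: r_def)
  have "\<forall>k<d. q v k - r v k = 0"
  proof (rule gp[OF _ J])
    show "finite (c ` {u \<in> X. E v u})" using X by simp
    show "c v \<notin> c ` {u \<in> X. E v u}" using cv by auto
    show "\<forall>j\<in>c ` {u \<in> X. E v u}. (\<Sum>k<d. (q v k - r v k) * (L (c v) k - L j k)) = 0"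
    proof
      fix j assume "j \<in> c ` {u \<in> X. E v u}"
      then obtain u where u: "j = c u" "u \<in> X" "E v u" by auto
      then have "(\<Sum>k<d. ((q v k - r v k) - (q u k - r u k)) * (?p v k - ?p u k)) = 0"
        using diff unfolding edge_flex_def by blast
      moreover have "(\<Sum>k<d. ((q v k - r v k) - (q u k - r u k)) * (?p v k - ?p u k))
          = (\<Sum>k<d. (q v k - r v k) * (L (c v) k - L j k))"
        using rX u by (intro sum.cong refl) auto
      ultimately show "(\<Sum>k<d. (q v k - r v k) * (L (c v) k - L j k)) = 0" by simp
    qed
  qed
  then have "\<forall>w\<in>insert v X. \<forall>k<d. q w k = t k + (\<Sum>l<d. S k l * ?p w l)"
    using qX by (auto simp: r_def)
  with S show "trivial_flex d (insert v X) ?p q"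
    unfolding trivial_flex_def by blast
qed

text \<open>A flex \<open>q\<close> of the blown-up complete framework is constant on each class, because the
  quantity \<open>q v \<bullet> (L i - L j)\<close> is constant on most of \<open>U i \<union> U j\<close> and two vertices of
  \<open>U i\<close> share at least \<open>d\<close> classes \<open>j\<close> for which neither is exceptional.\<close>

lemma inf_rigid_blow_up:
  fixes L :: "nat \<Rightarrow> nat \<Rightarrow> real" and c :: "'a \<Rightarrow> nat"
  assumes L0: "\<And>k. k < d \<Longrightarrow> L 0 k = 0"
    and L1: "\<And>i k. \<lbrakk>i < d; k < d\<rbrakk> \<Longrightarrow> L (Suc i) k = (if i = k then 1 else 0)"
    and gp: "\<And>i J y. \<lbrakk>finite J; d \<le> card J; i \<notin> J; \<forall>j\<in>J. (\<Sum>k<d. y k * (L i k - L j k)) = 0\<rbrakk>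
       \<Longrightarrow> \<forall>k<d. y k = 0"
    and d: "d > 0"
    and c: "\<And>i v. \<lbrakk>i < 3 * d; v \<in> U i\<rbrakk> \<Longrightarrow> c v = i"
    and size: "\<And>i. i < 3 * d \<Longrightarrow> s \<le> card (U i)"
    and XU: "\<And>i j. \<lbrakk>i < 3 * d; j < 3 * d; i \<noteq> j\<rbrakk> \<Longrightarrow> card (U i \<inter> X i j) < s"
    and Xsym: "\<And>i j. X i j = X j i"
    and few: "\<And>i v. \<lbrakk>i < 3 * d; v \<in> U i\<rbrakk> \<Longrightarrow> card {j. j < 3 * d \<and> j \<noteq> i \<and> v \<in> X i j} < d"
    and level: "\<And>i j (f :: 'a \<Rightarrow> real). \<lbrakk>i < 3 * d; j < 3 * d; i \<noteq> j;
        \<And>u w. \<lbrakk>u \<in> U i; w \<in> U j; E u w\<rbrakk> \<Longrightarrow> f u = f w\<rbrakk>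
      \<Longrightarrow> \<exists>c. \<forall>v\<in>(U i \<union> U j) - X i j. f v = c"
  shows "inf_rigid d E (\<Union>i<3*d. U i) (\<lambda>v. L (c v))"
  unfolding inf_rigid_def
proof (intro allI impI)
  let ?W = "\<Union>i<3*d. U i" and ?p = "\<lambda>v. L (c v)"
  fix q assume q: "edge_flex d E ?W ?p q"
  have const: "\<exists>b. \<forall>v\<in>(U i \<union> U j) - X i j. (\<Sum>k<d. q v k * (L i k - L j k)) = b"
    if ij: "i < 3*d" "j < 3*d" "i \<noteq> j" for i j
  proof (rule level[OF ij])
    fix u w assume uw: "u \<in> U i" "w \<in> U j" "E u w"
    then have "u \<in> ?W" "w \<in> ?W" using ij by auto
    then have "(\<Sum>k<d. (q u k - q w k) * (?p u k - ?p w k)) = 0"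
      using q uw(3) unfolding edge_flex_def by blast
    then show "(\<Sum>k<d. q u k * (L i k - L j k)) = (\<Sum>k<d. q w k * (L i k - L j k))"
      using c uw ij by (simp add: left_diff_distrib sum_subtractf)
  qed
  have eq: "\<forall>k<d. q v k - q v' k = 0" if i: "i < 3*d" and v: "v \<in> U i" "v' \<in> U i" for i v v'
  proof -
    \<comment> \<open>Each of the two vertices is exceptional for at most \<open>d - 1\<close>
      classes, so at least \<open>(3 * d - 1) - 2 * (d - 1) = d + 1\<close> classes remain.\<close>
    define bad where "bad v = {j. j < 3 * d \<and> j \<noteq> i \<and> v \<in> X i j}" for v
    define J where "J = {..<3*d} - {i} - (bad v \<union> bad v')"
    have "card (bad v \<union> bad v') \<le> card (bad v) + card (bad v')" by (rule card_Un_le)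
    moreover have "card (bad v) < d" "card (bad v') < d"
      unfolding bad_def by (rule few[OF i v(1)], rule few[OF i v(2)])
    moreover have "card ({..<3*d} - {i}) - card (bad v \<union> bad v') \<le> card J"
      unfolding J_def by (rule diff_card_le_card_Diff) (simp add: bad_def)
    moreover have "card ({..<3*d} - {i}) = 3 * d - 1" using i by simp
    ultimately have cardJ: "d \<le> card J" by linarith
    show ?thesis
    proof (rule gp[of J i])
      show "finite J" "d \<le> card J" "i \<notin> J" using cardJ by (auto simp: J_def)
      show "\<forall>j\<in>J. (\<Sum>k<d. (q v k - q v' k) * (L i k - L j k)) = 0"
      proof
        fix j assume "j \<in> J"
        then have j: "j < 3*d" "i \<noteq> j" "v \<notin> X i j" "v' \<notin> X i j" by (auto simp: J_def bad_def)
        obtain b where "\<forall>v\<in>(U i \<union> U j) - X i j. (\<Sum>k<d. q v k * (L i k - L j k)) = b"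
          using const[OF i j(1,2)] by blast
        then have "(\<Sum>k<d. q v k * (L i k - L j k)) = (\<Sum>k<d. q v' k * (L i k - L j k))"
          using v j by simp
        then show "(\<Sum>k<d. (q v k - q v' k) * (L i k - L j k)) = 0"
          by (simp add: left_diff_distrib sum_subtractf)
      qed
    qed
  qed
  have good: "\<exists>v. v \<in> U i \<and> v \<notin> X i j" if ij: "i < 3*d" "j < 3*d" "i \<noteq> j" for i j
  proof (rule ccontr)
    assume "\<not> ?thesis"
    then have "U i \<inter> X i j = U i" by blast
    then show False using XU[OF ij] size[OF ij(1)] by simp
  qed
  define w where "w i = (SOME v. v \<in> U i)" for i
  have w: "w i \<in> U i" if "i < 3*d" for i
  proof -
    \<comment> \<open>Any second index serves: a non-exceptional vertex for the pair witnesses that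
      \<open>U i\<close> is nonempty.\<close>
    define j :: nat where "j = (if i = 0 then 1 else 0)"
    have "j < 3*d" "i \<noteq> j" using d by (auto simp: j_def)
    then show ?thesis using good[OF that] unfolding w_def by (metis someI)
  qed
  define Q where "Q i = q (w i)" for i
  have Q: "q v k = Q i k" if "i < 3*d" "v \<in> U i" "k < d" for i v k
    using eq[OF that(1,2) w[OF that(1)]] that(3) by (simp add: Q_def)
  have "trivial_flex d {..<3*d} L Q"
  proof (rule complete_framework_flex_trivial[OF L0 L1])
    show "d < 3 * d" using d by simp
    fix i j assume ij: "i < 3*d" "j < 3*d" "i \<noteq> j"
    \<comment> \<open>Non-exceptional vertices in both classes have the same value of
      \<open>q\<close> against \<open>L i - L j\<close>, which is the flex condition for the points
      \<open>i\<close> and \<open>j\<close> even if \<open>v\<close> and \<open>v'\<close> are not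
      adjacent.\<close>
    obtain v where v: "v \<in> U i" "v \<notin> X i j" using good[OF ij] by blast
    obtain v' where v': "v' \<in> U j" "v' \<notin> X i j" using good[of j i] ij Xsym[of i j] by auto
    obtain b where "\<forall>v\<in>(U i \<union> U j) - X i j. (\<Sum>k<d. q v k * (L i k - L j k)) = b"
      using const[OF ij] by blast
    then have "(\<Sum>k<d. q v k * (L i k - L j k)) = (\<Sum>k<d. q v' k * (L i k - L j k))"
      using v v' by simp
    then show "(\<Sum>k<d. (Q i k - Q j k) * (L i k - L j k)) = 0"
      using Q[OF ij(1) v(1)] Q[OF ij(2) v'(1)] by (simp add: left_diff_distrib sum_subtractf)
  qed auto
  then obtain S t where S: "\<forall>k<d. \<forall>l<d. S k l = - S l k"
    and QS: "\<forall>i\<in>{..<3*d}. \<forall>k<d. Q i k = t k + (\<Sum>l<d. S k l * L i l)"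
    unfolding trivial_flex_def by blast
  have "\<forall>v\<in>?W. \<forall>k<d. q v k = t k + (\<Sum>l<d. S k l * ?p v l)"
  proof (intro ballI allI impI)
    fix v k assume "v \<in> ?W" and k: "k < d"
    then obtain i where i: "i < 3*d" "v \<in> U i" by auto
    then show "q v k = t k + (\<Sum>l<d. S k l * ?p v l)"
      using Q[OF i k] QS k c[OF i] by simp
  qed
  with S show "trivial_flex d ?W ?p q" unfolding trivial_flex_def by blast
qed


section \<open>Rigid subgraphs of connectors\<close>

lemma ex_disjoint_parts:
  assumes "finite V" and "M * m \<le> card V"
  obtains P :: "nat \<Rightarrow> 'a set" where
    "\<And>i. i < M \<Longrightarrow> P i \<subseteq> V" "\<And>i. i < M \<Longrightarrow> card (P i) = m"
    "\<And>i j. \<lbrakk>i < M; j < M; i \<noteq> j\<rbrakk> \<Longrightarrow> P i \<inter> P j = {}"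
proof -
  obtain h where h: "bij_betw h {0..<card V} V"
    using ex_bij_betw_nat_finite[OF \<open>finite V\<close>] by blast
  define P where "P i = h ` {i * m..<Suc i * m}" for i
  have sub: "{i * m..<Suc i * m} \<subseteq> {0..<card V}" if "i < M" for i
  proof -
    have "Suc i * m \<le> M * m" using that by (intro mult_le_mono1) simp
    then show ?thesis using assms(2) by auto
  qed
  have inj: "inj_on h {0..<card V}" using h by (rule bij_betw_imp_inj_on)
  show thesis
  proof (rule that)
    show "P i \<subseteq> V" if "i < M" for i
      using sub[OF that] bij_betw_imp_surj_on[OF h] unfolding P_def by blast
    show "card (P i) = m" if "i < M" for i
      unfolding P_def card_image[OF inj_on_subset[OF inj sub[OF that]]] by simp
    fix i j assume ij: "i < M" "j < M" "i \<noteq> j"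
    have D: "{i * m..<Suc i * m} \<inter> {j * m..<Suc j * m} = {}"
    proof (cases "i < j")
      case True
      then have "Suc i * m \<le> j * m" by (intro mult_le_mono1) simp
      then show ?thesis by auto
    next
      case False
      then have "Suc j * m \<le> i * m" using ij by (intro mult_le_mono1) simp
      then show ?thesis by auto
    qed
    then show "P i \<inter> P j = {}"
      by (simp only: P_def inj_on_image_Int[OF inj sub[OF ij(1)] sub[OF ij(2)], symmetric] D image_empty)
  qed
qed

text \<open>Starting from the blown-up framework on \<open>U0\<close>, vertices seeing at least
  \<open>d\<close> labels are added with fresh labels until a maximal \<open>W\<close> is reached.
  If \<open>s\<close> vertices were left over, \<open>W\<close> would be so small that many vertices
  are left over, each seeing too few of the \<open>3 * d\<close> classes for a connector.\<close>

lemma connector_contains_inf_rigid: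
  fixes E :: "'a \<Rightarrow> 'a \<Rightarrow> bool" and L :: "nat \<Rightarrow> nat \<Rightarrow> real"
  assumes V: "finite V" and s: "s > 0" and d: "d > 0" and n: "72 * s * d \<le> card V"
    and sym: "\<And>u v. E u v \<Longrightarrow> E v u"
    and conn: "\<And>A B. \<lbrakk>A \<subseteq> V; B \<subseteq> V; A \<inter> B = {}; s \<le> card A; s \<le> card B\<rbrakk> \<Longrightarrow> \<exists>a\<in>A. \<exists>b\<in>B. E a b"
    and L0: "\<And>k. k < d \<Longrightarrow> L 0 k = 0"
    and L1: "\<And>i k. \<lbrakk>i < d; k < d\<rbrakk> \<Longrightarrow> L (Suc i) k = (if i = k then 1 else 0)"
    and gp: "\<And>i J y. \<lbrakk>finite J; d \<le> card J; i \<notin> J; \<forall>j\<in>J. (\<Sum>k<d. y k * (L i k - L j k)) = 0\<rbrakk>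
       \<Longrightarrow> \<forall>k<d. y k = 0"
  shows "\<exists>W c. W \<subseteq> V \<and> card (V - W) < s \<and> {..<3 * d} \<subseteq> c ` W \<and> inf_rigid d E W (\<lambda>v. L (c v))"
proof -
  have "3 * d * (6 * s) \<le> card V" using n by (simp add: mult_ac)
  then obtain P :: "nat \<Rightarrow> 'a set" where PV: "\<And>i. i < 3*d \<Longrightarrow> P i \<subseteq> V"
    and cardP: "\<And>i. i < 3*d \<Longrightarrow> card (P i) = 6 * s"
    and disj: "\<And>i j. \<lbrakk>i < 3*d; j < 3*d; i \<noteq> j\<rbrakk> \<Longrightarrow> P i \<inter> P j = {}"
    using ex_disjoint_parts[OF V] by metis
  obtain U X where UP: "\<And>i. i < 3 * d \<Longrightarrow> U i \<subseteq> P i"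
    and cardU: "\<And>i. i < 3 * d \<Longrightarrow> 3 * s \<le> card (U i)"
    and Xsym: "\<And>i j. X i j = X j i"
    and XU: "\<And>i j. \<lbrakk>i < 3 * d; j < 3 * d; i \<noteq> j\<rbrakk> \<Longrightarrow> card (U i \<inter> X i j) < s"
    and few: "\<And>i v. \<lbrakk>i < 3 * d; v \<in> U i\<rbrakk> \<Longrightarrow> card {j. j < 3 * d \<and> j \<noteq> i \<and> v \<in> X i j} < d"
    and level: "\<And>i j (f :: 'a \<Rightarrow> real). \<lbrakk>i < 3 * d; j < 3 * d; i \<noteq> j;
        \<And>u w. \<lbrakk>u \<in> U i; w \<in> U j; E u w\<rbrakk> \<Longrightarrow> f u = f w\<rbrakk>
      \<Longrightarrow> \<exists>c. \<forall>v\<in>(U i \<union> U j) - X i j. f v = c"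
  proof (rule connector_peeling[of s d P E])
    show "finite (P i)" if "i < 3*d" for i using PV[OF that] V by (rule finite_subset)
    show "\<exists>a\<in>A. \<exists>b\<in>B. E a b"
      if "i < 3*d" "j < 3*d" "i \<noteq> j" "A \<subseteq> P i" "B \<subseteq> P j" "s \<le> card A" "s \<le> card B" for i j A B
    proof (rule conn)
      show "A \<subseteq> V" "B \<subseteq> V" using PV that by blast+
      show "A \<inter> B = {}" using disj[of i j] that by blast
    qed (use that in auto)
  qed (use s d cardP disj sym in auto)
  define U0 where "U0 = (\<Union>i<3*d. U i)"
  have UV: "U i \<subseteq> V" if "i < 3*d" for i using UP[OF that] PV[OF that] by blast
  then have U0V: "U0 \<subseteq> V" by (auto simp: U0_def)
  have finU: "finite (U i)" if "i < 3*d" for i using UV[OF that] V by (rule finite_subset)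
  have cardU0: "card U0 \<le> 18 * s * d"
  proof -
    have "card U0 \<le> (\<Sum>i<3*d. card (U i))"
      unfolding U0_def by (rule card_UN_le) simp
    also have "\<dots> \<le> (\<Sum>i<3*d. 6 * s)"
    proof (rule sum_mono)
      fix i assume "i \<in> {..<3*d}"
      then have i: "i < 3*d" by simp
      show "card (U i) \<le> 6 * s"
        using card_mono[OF finite_subset[OF PV[OF i] V] UP[OF i]] cardP[OF i] by simp
    qed
    finally show ?thesis by (simp add: mult_ac)
  qed
  define good where "good W c \<longleftrightarrow> U0 \<subseteq> W \<and> W \<subseteq> V \<and> (\<forall>i<3*d. \<forall>v\<in>U i. c v = i) \<and>
      inj_on c (W - U0) \<and> inf_rigid d E W (\<lambda>v. L (c v))" for W c
  define c0 where "c0 v = (THE i. i < 3*d \<and> v \<in> U i)" for v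
  have c0: "c0 v = i" if "i < 3*d" "v \<in> U i" for i v
    unfolding c0_def
  proof (rule the_equality)
    fix j assume "j < 3*d \<and> v \<in> U j"
    then show "j = i" using disj[of i j] UP[of i] UP[of j] that by blast
  qed (use that in simp)
  have "inf_rigid d E U0 (\<lambda>v. L (c0 v))"
    unfolding U0_def
  proof (rule inf_rigid_blow_up[where s = s and X = X])
    show "s \<le> card (U i)" if "i < 3 * d" for i using cardU[OF that] by simp
  qed (fact L0 L1 gp d c0 XU Xsym few level)+
  then have "good U0 c0" using U0V c0 by (simp add: good_def)
  then have ne: "{W. \<exists>c. good W c} \<noteq> {}" by blast
  have fin: "finite {W. \<exists>c. good W c}"
    by (rule finite_subset[of _ "Pow V"]) (use V in \<open>auto simp: good_def\<close>)
  from finite_has_maximal[OF fin ne] obtain W where W: "W \<in> {W. \<exists>c. good W c}"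
    and "\<forall>W'\<in>{W. \<exists>c. good W c}. W \<subseteq> W' \<longrightarrow> W = W'" ..
  then have max: "W' = W" if "good W' c" "W \<subseteq> W'" for W' c using that by blast
  obtain c where good: "good W c" using W by blast
  have WV: "W \<subseteq> V" and U0W: "U0 \<subseteq> W" and cU: "\<And>i v. \<lbrakk>i < 3*d; v \<in> U i\<rbrakk> \<Longrightarrow> c v = i"
    and inj: "inj_on c (W - U0)" and rigid: "inf_rigid d E W (\<lambda>v. L (c v))"
    using good by (auto simp: good_def)
  have finW: "finite W" using WV V by (rule finite_subset)
  have few_labels: "card (c ` {u \<in> W. E v u}) < d" if v: "v \<in> V - W" for v
  proof (rule ccontr)
    assume "\<not> ?thesis"
    then have many: "d \<le> card (c ` {u \<in> W. E v u})" by simp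
    obtain x where x: "x \<notin> c ` W"
      using ex_new_if_finite[OF infinite_UNIV_nat finite_imageI[OF finW]] by blast
    define c' where "c' = c(v := x)"
    have c'W: "c' u = c u" if "u \<in> W" for u using that v by (auto simp: c'_def)
    then have im: "c' ` Y = c ` Y" if "Y \<subseteq> W" for Y
      using that by (intro image_cong) auto
    have "inf_rigid d E W (\<lambda>v. L (c' v))"
      by (rule inf_rigid_cong[OF _ rigid]) (simp add: c'W)
    moreover have "d \<le> card (c' ` {u \<in> W. E v u})"
      using many im[of "{u \<in> W. E v u}"] by simp
    moreover have "c' v \<notin> c' ` W" using x im[of W] by (simp add: c'_def)
    ultimately have "inf_rigid d E (insert v W) (\<lambda>v. L (c' v))"
      by (intro inf_rigid_insert[OF gp finW])
    moreover have "inj_on c' (insert v W - U0)"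
    proof -
      have "inj_on c' (W - U0)" using inj c'W by (simp add: inj_on_def)
      moreover have "insert v W - U0 = insert v (W - U0)" using v U0W by blast
      moreover have "c' v \<notin> c' ` (W - U0)" using \<open>c' v \<notin> c' ` W\<close> by blast
      ultimately show ?thesis using v by (simp add: inj_on_insert)
    qed
    moreover have "c' u = i" if "i < 3*d" "u \<in> U i" for i u
    proof -
      have "u \<in> W" using that U0W by (auto simp: U0_def)
      then show ?thesis using c'W cU that by simp
    qed
    ultimately have "good (insert v W) c'"
      using v U0W WV by (auto simp: good_def)
    then show False using max[of "insert v W" c'] v by blast
  qed
  have "card (V - W) < s"
  proof (rule ccontr)
    assume "\<not> ?thesis"
    then obtain A where A: "A \<subseteq> V - W" "card A = s"
      by (meson not_less obtain_subset_with_card_n)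
    \<comment> \<open>Added vertices have distinct labels, so each vertex of \<open>A\<close> has at
      most \<open>d - 1\<close> neighbours among them. The added vertices outside \<open>N\<close>
      have no edge to \<open>A\<close>, so there are fewer than \<open>s\<close> of them, and
      \<open>W - U0\<close> has fewer than \<open>s * d\<close> vertices in all.\<close>
    define N where "N = (\<Union>a\<in>A. {u \<in> W - U0. E a u})"
    have finA: "finite A" using A(1) V by (meson finite_Diff finite_subset)
    have "card N \<le> (\<Sum>a\<in>A. card {u \<in> W - U0. E a u})"
      unfolding N_def by (rule card_UN_le[OF finA])
    also have "\<dots> \<le> (\<Sum>a\<in>A. d - 1)"
    proof (rule sum_mono)
      fix a assume "a \<in> A"
      have "card {u \<in> W - U0. E a u} = card (c ` {u \<in> W - U0. E a u})"
        by (intro card_image[symmetric] inj_on_subset[OF inj]) auto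
      also have "\<dots> \<le> card (c ` {u \<in> W. E a u})"
        using finW by (intro card_mono image_mono) auto
      also have "\<dots> < d" using few_labels \<open>a \<in> A\<close> A by blast
      finally show "card {u \<in> W - U0. E a u} \<le> d - 1" by simp
    qed
    finally have N: "card N \<le> s * (d - 1)" using A(2) by simp
    have "card (W - U0 - N) < s"
    proof (rule ccontr)
      assume "\<not> ?thesis"
      then have 1: "s \<le> card (W - U0 - N)" by simp
      obtain a b where "a \<in> A" "b \<in> W - U0 - N" "E a b"
        using conn[OF _ _ _ _ 1, of A] A WV by blast
      then show False by (auto simp: N_def)
    qed
    moreover have "card (W - U0) \<le> card (W - U0 - N) + card N"
    proof -
      have "card (W - U0) \<le> card ((W - U0 - N) \<union> N)"
        using finW finA by (intro card_mono) (auto simp: N_def)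
      then show ?thesis using card_Un_le[of "W - U0 - N" N] by linarith
    qed
    ultimately have "card (W - U0) < s + s * (d - 1)" using N by linarith
    also have "s + s * (d - 1) = s * d" using d by (cases d) auto
    finally have "card (W - U0) < s * d" .
    moreover have "card W = card (W - U0) + card U0"
      using card_Int_Diff[OF finW, of U0] U0W by (simp add: Int_absorb1 add.commute)
    moreover have "card (V - W) = card V - card W" using finW WV by (rule card_Diff_subset)
    \<comment> \<open>\<open>53 = 72 - 18 - 1\<close>: at most \<open>18 * s * d\<close> vertices
      lie in the classes and fewer than \<open>s * d\<close> were added.\<close>
    ultimately have "53 * s * d \<le> card (V - W)" using n cardU0 by simp
    then have big: "2 * s \<le> card (V - W)"
    proof -
      have "2 * s \<le> 53 * s * d" using d by (cases d) auto
      with \<open>53 * s * d \<le> card (V - W)\<close> show ?thesis by linarith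
    qed
    \<comment> \<open>A vertex outside \<open>W\<close> sees fewer than \<open>d\<close> labels, so
      it has no neighbour in at least \<open>2 * d\<close> classes. A class, having at least
      \<open>s\<close> vertices, is missed by at most \<open>s - 1\<close> vertices. With
      \<open>2 * s\<close> vertices outside \<open>W\<close> this would give
      \<open>4 * d * s \<le> 3 * d * s\<close>.\<close>
    have "(2 * d) * card (V - W) \<le> (s - 1) * card {..<3*d}"
    proof (rule card_double_count_le)
      show "2 * d \<le> card {j \<in> {..<3*d}. \<forall>u\<in>U j. \<not> E a u}" if a: "a \<in> V - W" for a
      proof -
        let ?C = "{j \<in> {..<3*d}. \<exists>u\<in>U j. E a u}"
        have "?C \<subseteq> c ` {u \<in> W. E a u}"
        proof
          fix j assume "j \<in> ?C"
          then obtain u where u: "j < 3*d" "u \<in> U j" "E a u" by auto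
          then have "u \<in> {u \<in> W. E a u}" using U0W by (auto simp: U0_def)
          then show "j \<in> c ` {u \<in> W. E a u}" using cU[OF u(1,2)] by blast
        qed
        then have "card ?C \<le> card (c ` {u \<in> W. E a u})" using finW by (intro card_mono) auto
        then have "card ?C < d" using few_labels[OF a] by linarith
        moreover have "card {..<3*d} = card ?C + card ({..<3*d} - ?C)"
        proof -
          have "{..<3*d} \<inter> ?C = ?C" by auto
          then show ?thesis using card_Int_Diff[OF finite_lessThan, of "3*d" ?C] by argo
        qed
        moreover have "{..<3*d} - ?C = {j \<in> {..<3*d}. \<forall>u\<in>U j. \<not> E a u}" by auto
        ultimately show ?thesis by simp
      qed
      show "card {a \<in> V - W. \<forall>u\<in>U j. \<not> E a u} \<le> s - 1" if j: "j \<in> {..<3*d}" for j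
      proof (rule ccontr)
        assume "\<not> ?thesis"
        then have 1: "s \<le> card {a \<in> V - W. \<forall>u\<in>U j. \<not> E a u}" by simp
        have 2: "s \<le> card (U j)" using cardU[of j] j by simp
        have "U j \<subseteq> W" using j U0W by (auto simp: U0_def)
        then have "\<exists>a\<in>{a \<in> V - W. \<forall>u\<in>U j. \<not> E a u}. \<exists>b\<in>U j. E a b"
          using WV by (intro conn[OF _ _ _ 1 2]) auto
        then show False by blast
      qed
    qed (use V in auto)
    moreover have "(2 * d) * (2 * s) \<le> (2 * d) * card (V - W)" using big by (rule mult_le_mono2)
    moreover have "(s - 1) * card {..<3*d} \<le> s * (3 * d)" by simp
    ultimately have "(2 * d) * (2 * s) \<le> s * (3 * d)" by linarith
    then show False using s d by (simp add: mult_ac)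
  qed
  \<comment> \<open>All class labels occur, so the origin and the unit vectors are among the points;
    this later shows that the placement spans.\<close>
  moreover have "{..<3*d} \<subseteq> c ` W"
  proof
    fix i assume "i \<in> {..<3*d}"
    then have i: "i < 3*d" by simp
    then have "U i \<noteq> {}" using cardU[OF i] s by auto
    then obtain v where v: "v \<in> U i" by blast
    then have "v \<in> W" using i U0W by (auto simp: U0_def)
    then show "i \<in> c ` W" using cU[OF i v] by blast
  qed
  ultimately show ?thesis using WV rigid by blast
qed

section \<open>From a special placement to a generic one\<close>

lemma algebraically_independent_cong:
  assumes "\<And>i. i \<in> I \<Longrightarrow> x i = y i" and x: "algebraically_independent_over_rat I x"
  shows "algebraically_independent_over_rat I y"
proof -
  have "rat_mpoly_eval x f = rat_mpoly_eval y f"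
    if "\<forall>m\<in>Poly_Mapping.keys f. Poly_Mapping.keys m \<subseteq> I" for f
    unfolding rat_mpoly_eval_def
  proof (intro sum.cong refl arg_cong2[where f = "(*)"] prod.cong)
    fix m i assume "m \<in> Poly_Mapping.keys f" "i \<in> Poly_Mapping.keys m"
    then have "i \<in> I" using that by blast
    then show "x i ^ Poly_Mapping.lookup m i = y i ^ Poly_Mapping.lookup m i" by (simp add: assms(1))
  qed
  then show ?thesis using x unfolding algebraically_independent_over_rat_def by metis
qed

lemma euclidean_dist_eq_iff:
  "euclidean_dist d x y = euclidean_dist d x' y' \<longleftrightarrow> sq_dist d x y = sq_dist d x' y'"
  by (simp add: euclidean_dist_def sq_dist_def L2_set_def)

text \<open>A generic placement close to \<open>p0\<close> still spans and has a whole ball of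
  infinitesimally rigid placements around it, so the framework it defines is rigid under continuous
  motions.\<close>

lemma d_rigid_if_inf_rigid:
  assumes W: "finite W" and span: "spanning d W p0"
    and rigid: "inf_rigid d (dominates G) W p0"
  shows "d_rigid d (induce_subgraph G W)"
proof -
  let ?H = "induce_subgraph G W"
  have dom: "dominates ?H u v" if "dominates G u v" "u \<in> W" "v \<in> W" for u v
    using that by (auto simp: arcs_ends_conv)
  obtain e1 where e1: "e1 > 0" and E1: "\<forall>p. (\<forall>v\<in>W. \<forall>k<d. \<bar>p v k - p0 v k\<bar> < e1) \<longrightarrow> inf_rigid d (dominates G) W p"
    using inf_rigid_open[OF W rigid] by blast
  obtain e2 where e2: "e2 > 0" and E2: "\<forall>p. (\<forall>v\<in>W. \<forall>k<d. \<bar>p v k - p0 v k\<bar> < e2) \<longrightarrow> spanning d W p"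
    using spanning_open[OF W span] by blast
  \<comment> \<open>Halving \<open>e1\<close> keeps the ball of radius \<open>e\<close> around the
    generic placement inside the ball of radius \<open>e1\<close> around \<open>p0\<close>.\<close>
  define e where "e = min (e1 / 2) e2"
  have e: "e > 0" "e \<le> e1 / 2" "e \<le> e2" using e1 e2 by (auto simp: e_def)
  obtain x where x: "algebraically_independent_over_rat (W \<times> {..<d}) x"
    and near: "\<forall>i\<in>W \<times> {..<d}. \<bar>x i - case_prod p0 i\<bar> < e"
    using algebraically_independent_dense[of "W \<times> {..<d}" e "case_prod p0"] W e(1) by auto
  \<comment> \<open>Coordinates from \<open>d\<close> on are set to zero, as membership in
    \<open>Euclidean_space d\<close> demands.\<close>
  define p where "p v k = (if k < d then x (v, k) else 0)" for v k
  have p_near: "\<bar>p v k - p0 v k\<bar> < e" if "v \<in> W" "k < d" for v k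
    using near that by (auto simp: p_def)
  have span_p: "spanning d W p" using E2 p_near e(3) by (meson less_le_trans)
  have "placement d ?H p"
    by (simp add: placement_def topspace_Euclidean_space p_def)
  moreover have "algebraically_independent_over_rat (W \<times> {..<d}) (\<lambda>(v, i). p v i)"
    by (rule algebraically_independent_cong[OF _ x]) (auto simp: p_def)
  ultimately have generic: "generic_placement d ?H p"
    by (simp add: generic_placement_def)
  have "rigid_framework d ?H p"
    unfolding rigid_framework_def
  proof (intro conjI allI impI ballI)
    show "placement d ?H p" by fact
    fix P t u v
    assume P: "edge_preserving_motion d ?H p P" and t: "t \<in> {0..1::real}"
      and uv: "u \<in> verts ?H" "v \<in> verts ?H"
    have cont: "continuous_on {0..1} (\<lambda>t. P t v k)" if "v \<in> W" for v k
    proof -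
      have "continuous_map (top_of_set {0..1}) (Euclidean_space d) (\<lambda>t. P t v)"
        using P that by (simp add: edge_preserving_motion_def)
      then show ?thesis
        by (simp add: Euclidean_space_def continuous_map_in_subtopology continuous_map_componentwise_UNIV)
    qed
    have "sq_dist d (P t u) (P t v) = sq_dist d (p u) (p v)"
    proof (rule inf_rigid_nbhd_imp_rigid[OF W span_p e(1), where E = "dominates G"])
      fix p' assume p': "\<forall>v\<in>W. \<forall>k<d. \<bar>p' v k - p v k\<bar> < e"
      have "\<bar>p' v k - p0 v k\<bar> < e1" if "v \<in> W" "k < d" for v k
      proof -
        have "\<bar>p' v k - p v k\<bar> < e" using p' that by blast
        with p_near[OF that] e(2) show ?thesis by linarith
      qed
      then show "inf_rigid d (dominates G) W p'" using E1 by blast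
    next
      show "continuous_on {0..1} (\<lambda>t. P t v k)" if "v \<in> W" for v k by (rule cont[OF that])
      show "P 0 v k = p v k" if "v \<in> W" for v k
        using P that by (simp add: edge_preserving_motion_def)
      show "sq_dist d (P t u) (P t v) = sq_dist d (p u) (p v)"
        if "t \<in> {0..1}" "u \<in> W" "v \<in> W" "dominates G u v" for t u v
        using P that dom[OF that(4,2,3)]
        by (auto simp: edge_preserving_motion_def euclidean_dist_eq_iff)
    qed (use t uv in auto)
    then show "euclidean_dist d (P t u) (P t v) = euclidean_dist d (p u) (p v)"
      by (simp add: euclidean_dist_eq_iff)
  qed
  with generic show ?thesis unfolding d_rigid_def by blast
qed

theorem corollary1p8:
  fixes s n :: nat and G :: "('a, 'b) pre_digraph"
  assumes "s > 0" and "n > 0" and "n \<ge> 72 * s"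
    and "graph G" and "card (verts G) = n" and "s_connector s G"
  shows "\<exists>U. U \<subseteq> verts G \<and> card U > n - s \<and>
           d_rigid (n div (72 * s)) (induce_subgraph G U)"
proof -
  interpret graph G by fact
  define d where "d = n div (72 * s)"
  have d: "d > 0" using assms(1,3) by (simp add: d_def div_greater_zero_iff)
  have n: "72 * s * d \<le> card (verts G)" using assms(5) by (simp add: d_def)
  \<comment> \<open>The connector property speaks of sets of size exactly \<open>s\<close>; larger
    sets are reduced to subsets of that size.\<close>
  have conn: "\<exists>a\<in>A. \<exists>b\<in>B. dominates G a b"
    if AB: "A \<subseteq> verts G" "B \<subseteq> verts G" "A \<inter> B = {}" "s \<le> card A" "s \<le> card B" for A B
  proof -
    obtain A' where A': "A' \<subseteq> A" "card A' = s" using AB(4) by (rule obtain_subset_with_card_n)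
    obtain B' where B': "B' \<subseteq> B" "card B' = s" using AB(5) by (rule obtain_subset_with_card_n)
    have "A' \<subseteq> verts G \<and> B' \<subseteq> verts G \<and> card A' = s \<and> card B' = s \<and> A' \<inter> B' = {}"
      using A' B' AB by blast
    then have "\<exists>a\<in>A'. \<exists>b\<in>B'. dominates G a b"
      using assms(6) unfolding s_connector_def by blast
    then show ?thesis using A'(1) B'(1) by blast
  qed
  have sym: "dominates G v u" if "dominates G u v" for u v
    using arcs_ends_symmetric[OF sym_arcs that] .
  obtain L :: "nat \<Rightarrow> nat \<Rightarrow> real" where L: "\<forall>k<d. L 0 k = 0"
    "\<forall>i<d. \<forall>k<d. L (Suc i) k = (if i = k then 1 else 0)"
    "\<forall>i J y. finite J \<and> d \<le> card J \<and> i \<notin> J \<and> (\<forall>j\<in>J. (\<Sum>k<d. y k * (L i k - L j k)) = 0) \<longrightarrow>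
       (\<forall>k<d. y k = 0)"
    by (rule ex_general_position_sequence[of d])
  have L0: "L 0 k = 0" if "k < d" for k
    using L(1) that by blast
  have L1: "L (Suc i) k = (if i = k then 1 else 0)" if "i < d" "k < d" for i k
    using L(2) that by blast
  have gp: "\<forall>k<d. y k = 0"
    if "finite J" "d \<le> card J" "i \<notin> J" "\<forall>j\<in>J. (\<Sum>k<d. y k * (L i k - L j k)) = 0" for i J y
    using L(3) that by blast
  have "\<exists>W c. W \<subseteq> verts G \<and> card (verts G - W) < s \<and> {..<3 * d} \<subseteq> c ` W \<and>
      inf_rigid d (dominates G) W (\<lambda>v. L (c v))"
    by (rule connector_contains_inf_rigid) (fact finite_verts assms(1) d n sym conn L0 L1 gp)+
  then obtain W c where W: "W \<subseteq> verts G" "card (verts G - W) < s" "{..<3 * d} \<subseteq> c ` W"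
    and rigid: "inf_rigid d (dominates G) W (\<lambda>v. L (c v))"
    by blast
  have finW: "finite W" using W(1) finite_verts by (rule finite_subset)
  have "spanning d W (\<lambda>v. L (c v))"
    unfolding spanning_def
  proof (intro allI impI)
    fix y :: "nat \<Rightarrow> real" and k
    assume y: "\<forall>u\<in>W. \<forall>v\<in>W. (\<Sum>k<d. y k * (L (c u) k - L (c v) k)) = 0" and k: "k < d"
    \<comment> \<open>The points labelled \<open>Suc k\<close> and \<open>0\<close> differ by the
      unit vector of axis \<open>k\<close>, which isolates \<open>y k\<close>.\<close>
    have "0 \<in> {..<3*d}" "Suc k \<in> {..<3*d}" using k by auto
    then obtain u v where uv: "u \<in> W" "c u = Suc k" "v \<in> W" "c v = 0"
      using W(3) by (metis imageE subsetD)
    have "0 = (\<Sum>m<d. y m * (L (Suc k) m - L 0 m))"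
      using y uv by metis
    also have "\<dots> = (\<Sum>m<d. if k = m then y k else 0)"
      using k by (intro sum.cong refl) (auto simp: L0 L1)
    finally show "y k = 0" using k by simp
  qed
  then have "d_rigid d (induce_subgraph G W)"
    using finW rigid by (intro d_rigid_if_inf_rigid)
  moreover have "card W > n - s"
  proof -
    have "card W \<le> n" using card_mono[OF finite_verts W(1)] assms(5) by simp
    moreover have "card (verts G - W) = n - card W"
      using card_Diff_subset[OF finW W(1)] assms(5) by simp
    ultimately show ?thesis using W(2) assms(1,3) by linarith
  qed
  ultimately show ?thesis using W(1) unfolding d_def by blast
qed

end
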